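(* We have: (i) $|CI_n(4321,132)|=\lfloor\frac{n}{2}\rfloor$; (ii) $CI_n(4321,321)=CI_n(321)$; moreover, $|CI_{2h}(4321,321)|=2^h$ and $|CI_{2h+1}(4321,321)|=\binom{h}{\lfloor h/2\rfloor}$; (iii) $|CI_n(4321,312)|=t_{\lfloor n/2\rfloor+1}+t_{\lfloor n/2\rfloor+2}$, where $t_k$ denotes the $k$-th Tribonacci number; (iv) $|CI_n(3412,132)|=\lfloor\frac{n}{2}\rfloor$; (v) $|CI_{2h}(3412,321)|=F_{h+2}$ and $|CI_{2h+1}(3412,321)|=F_{h+1}$, where $F_k$ denotes the $k$-th Fibonacci number; (vi) $CI_n(3412,312)=CI_n(312)$ and $|CI_n(3412,312)|=2^{\lfloor n/2\rfloor}$; (vii) $|CI_{2h}(3412,123)|=h+1$ and $|CI_{2h+1}(3412,123)|=1$; (viii) $|CI_n(3412,4321)|=2^{\lfloor n/2\rfloor}$.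
   Context: $CI_n$ is the set of centrosymmetric involutions in the symmetric group $S_n$, i.e. involutions $\tau\in S_n$ with $\tau(i)+\tau(n+1-i)=n+1$ for every $1\le i\le n$. A permutation $\sigma\in S_n$ contains the pattern $\pi\in S_k$ if there are $1\le i_1<\dots<i_k\le n$ such that $(\sigma(i_1),\dots,\sigma(i_k))$ is order-isomorphic to $\pi$; otherwise $\sigma$ avoids $\pi$. $CI_n(\pi_1,\dots,\pi_r)$ denotes the set of elements of $CI_n$ avoiding all of $\pi_1,\dots,\pi_r$. Tribonacci numbers: $t_0=t_1=0$, $t_2=1$, $t_{k+3}=t_{k+2}+t_{k+1}+t_k$. Fibonacci numbers: $F_1=F_2=1$, $F_{k+2}=F_{k+1}+F_k$.
   Formalization: In (i) and (iv) the count is ⌊n/2⌋+1 instead of the printed ⌊n/2⌋, which is false: for n=2 both 12 and 21 are centrosymmetric involutions avoiding 132, 4321 and 3412, so the count is 2, not 1. *)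

theory Defs
  imports
    "HOL-Combinatorics.Permutations"
    "HOL-Number_Theory.Fib"
begin

text \<open>
  The symmetric group on \<open>n\<close> letters is the set of functions that permute \<open>{1..n}\<close> (and are the
  identity elsewhere). Involution means that the square is the identity, so the identity
  permutation counts as an involution.
\<close>

definition centrosymmetric_involutions :: "nat \<Rightarrow> (nat \<Rightarrow> nat) set" where
  "centrosymmetric_involutions n =
     {\<tau>. \<tau> permutes {1..n} \<and> \<tau> \<circ> \<tau> = id \<and> (\<forall>i\<in>{1..n}. \<tau> i + \<tau> (n + 1 - i) = n + 1)}"

text \<open>
  A pattern is given by its one-line notation, e.g. \<open>[1, 3, 2]\<close>. Lists are indexed from \<open>0\<close>,
  so \<open>idx 0 < \<dots> < idx (k - 1)\<close> are the positions of the occurrence in \<open>\<sigma>\<close>.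
\<close>

definition contains_pattern :: "nat \<Rightarrow> (nat \<Rightarrow> nat) \<Rightarrow> nat list \<Rightarrow> bool" where
  "contains_pattern n \<sigma> \<pi> \<longleftrightarrow>
     (\<exists>idx :: nat \<Rightarrow> nat.
        strict_mono_on {..<length \<pi>} idx \<and>
        idx ` {..<length \<pi>} \<subseteq> {1..n} \<and>
        (\<forall>a<length \<pi>. \<forall>b<length \<pi>. \<sigma> (idx a) < \<sigma> (idx b) \<longleftrightarrow> \<pi> ! a < \<pi> ! b))"

definition CI :: "nat \<Rightarrow> nat list set \<Rightarrow> (nat \<Rightarrow> nat) set" where
  "CI n P = {\<tau> \<in> centrosymmetric_involutions n. \<forall>\<pi>\<in>P. \<not> contains_pattern n \<tau> \<pi>}"

fun tribonacci :: "nat \<Rightarrow> nat" where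
  "tribonacci 0 = 0"
| "tribonacci (Suc 0) = 0"
| "tribonacci (Suc (Suc 0)) = 1"
| "tribonacci (Suc (Suc (Suc k))) = tribonacci (Suc (Suc k)) + tribonacci (Suc k) + tribonacci k"

text \<open>
  A caveat on the pairs \<open>{4321, 132}\<close> and \<open>{3412, 132}\<close>: their avoiders number \<open>n div 2 + 1\<close>.
  The value \<open>n div 2\<close> given for them in print is off by one; for instance, both elements of the
  symmetric group on two letters are centrosymmetric involutions avoiding these patterns.
\<close>

end

theory Submission
  imports Defs
begin

text \<open>
  A centrosymmetric involution \<open>\<tau>\<close> of \<open>{1..n}\<close> commutes with the reversal \<open>i \<mapsto> n + 1 - i\<close>. Composing
  the two gives a centrosymmetric involution again, whose patterns are the reversed patterns of
  \<open>\<tau>\<close> (\<open>card_CI_reverse\<close>). So the pairs (4321, 132), (3412, 132) and (3412, 123) may be traded for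
  (1234, 231), (2143, 231) and (2143, 321). Moreover \<open>\<tau>\<close> is its own inverse, so that 231 may be
  replaced by its inverse 312. After this every pair contains 312, or 321, or is (3412, 4321).

  Suppose that 312 is avoided, or 3412 together with 321 or 4321. Then \<open>\<tau>\<close> maps \<open>{1..\<tau> 1}\<close> to
  itself, and in a way that depends on \<open>\<tau> 1\<close> only: it reverses this interval in the first case, and
  it only exchanges the two end points in the second. By centrosymmetry \<open>\<tau>\<close> ends with a block of
  the same kind, so \<open>\<tau>\<close> is a single block or a direct sum \<open>\<beta> \<oplus> \<tau>' \<oplus> \<beta>\<close> (\<open>ci_first_block\<close>). The
  patterns 312, 321, 3412 and 4321 are not direct sums themselves, hence occur in such a sum only
  within one summand. Therefore these classes are counted by the palindromic compositions of \<open>n\<close>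
  whose parts are sizes of admissible blocks (\<open>card_CI_blocks\<close>): all parts lead to powers of two,
  parts up to three to Tribonacci numbers, and parts up to two to Fibonacci numbers. The patterns
  1234 and 2143 are direct sums; among the permutations with decreasing blocks the first one
  bounds the number of blocks by three, and the second one allows only one block of size
  greater than one.

  An involution avoids 321 exactly if its arcs \<open>{i, \<tau> i}\<close> do not nest and no fixed point lies below
  an arc (\<open>ci_avoids_321_iff\<close>). A centrosymmetric one is determined by its left half, in which the
  arcs across the middle are left open (\<open>half_bij\<close>). A left half can be prolonged by one position in
  exactly two ways: the new position opens an arc, or it closes the earliest open arc, becoming a
  fixed point if there is none (\<open>open_matchings_Suc\<close>). This yields \<open>2 ^ h\<close> halves of length \<open>h\<close>, and
  counting open arcs gives binomial coefficients. If \<open>n\<close> is odd, the middle position is a fixed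
  point, and no arc may be open. Avoiding 2143 in addition forbids closed arcs, which leaves
  only the number of fixed points to be chosen.
\<close>

section \<open>Monotone self-maps of a finite set\<close>

text \<open>At the least moved point the map cannot go down, since the value there is already
  taken by a smaller fixed point, and it cannot go up, since then nothing would be sent to that point.\<close>

lemma strict_mono_self_map_id:
  fixes f :: "'a::wellorder \<Rightarrow> 'a"
  assumes "finite A" "f ` A \<subseteq> A" and mono: "\<And>x y. x \<in> A \<Longrightarrow> y \<in> A \<Longrightarrow> x < y \<Longrightarrow> f x < f y"
    and "x \<in> A"
  shows "f x = x"
  using \<open>x \<in> A\<close>
proof (induction x rule: less_induct)
  case (less x)
  have inj: "inj_on f A"
    using mono by (metis inj_onI less_irrefl neqE)
  then have "f ` A = A"
    using assms(1,2) by (metis endo_inj_surj)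
  then obtain k where k: "k \<in> A" "f k = x"
    using less.prems by (metis imageE)
  show ?case
  proof (rule linorder_cases[of "f x" x])
    assume "f x < x"
    moreover from this have "f (f x) = f x"
      using less assms(2) by blast
    ultimately show ?thesis
      using mono[of "f x" x] less.prems assms(2) by auto
  next
    assume "x < f x"
    then show ?thesis
      using k less mono[of x k] by (metis less_asym neqE)
  qed auto
qed

lemma strict_antimono_self_map_involution:
  fixes g :: "'a::wellorder \<Rightarrow> 'a"
  assumes "finite A" "g ` A \<subseteq> A" and "\<And>x y. x \<in> A \<Longrightarrow> y \<in> A \<Longrightarrow> x < y \<Longrightarrow> g y < g x"
    and "x \<in> A"
  shows "g (g x) = x"
  using strict_mono_self_map_id[of A "\<lambda>x. g (g x)" x] assms by (simp add: image_subset_iff)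

text \<open>Two order-reversing self-maps compose to an order-preserving one, which is the identity.\<close>

lemma strict_antimono_self_map_unique:
  fixes g g' :: "'a::wellorder \<Rightarrow> 'a"
  assumes A: "finite A" and g: "g ` A \<subseteq> A" "\<And>x y. x \<in> A \<Longrightarrow> y \<in> A \<Longrightarrow> x < y \<Longrightarrow> g y < g x"
    and g': "g' ` A \<subseteq> A" "\<And>x y. x \<in> A \<Longrightarrow> y \<in> A \<Longrightarrow> x < y \<Longrightarrow> g' y < g' x"
    and x: "x \<in> A"
  shows "g x = g' x"
proof -
  have "g (g' x) = x"
    using strict_mono_self_map_id[of A "\<lambda>x. g (g' x)" x] assms by (simp add: image_subset_iff)
  then show ?thesis
    using strict_antimono_self_map_involution[OF A g, of "g' x"] g' x by (metis image_subset_iff)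
qed

text \<open>Exchange the minimum and the maximum and recurse on the points in between.\<close>

lemma ex_strict_antimono_self_map:
  fixes A :: "'a::linorder set"
  assumes "finite A"
  shows "\<exists>g. g ` A \<subseteq> A \<and> (\<forall>x\<in>A. \<forall>y\<in>A. x < y \<longrightarrow> g y < g x)"
  using assms
proof (induction A rule: finite_psubset_induct)
  case (psubset A)
  show ?case
  proof (cases "A = {}")
    case False
    define m M B where "m = Min A" and "M = Max A" and "B = A - {m, M}"
    have mM: "m \<in> A" "M \<in> A" and bounds: "\<And>x. x \<in> A \<Longrightarrow> m \<le> x \<and> x \<le> M"
      using psubset.hyps False by (auto simp: m_def M_def)
    then have "B \<subset> A"
      by (auto simp: B_def)
    obtain g where g: "g ` B \<subseteq> B" "\<forall>x\<in>B. \<forall>y\<in>B. x < y \<longrightarrow> g y < g x"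
      using psubset.IH[OF \<open>B \<subset> A\<close>] by blast
    have gB: "g x \<in> B" "g x \<in> A" "m < g x" "g x < M" if "x \<in> B" for x
      using g(1) bounds[of "g x"] that by (auto simp: B_def image_subset_iff less_le)
    let ?g = "\<lambda>x. if x = m then M else if x = M then m else g x"
    have "?g ` A \<subseteq> A"
      using gB mM by (auto simp: B_def)
    moreover have "?g y < ?g x" if "x \<in> A" "y \<in> A" "x < y" for x y
    proof -
      have "x \<noteq> M" "y \<noteq> m"
        using that bounds by (metis leD)+
      then show ?thesis
        using that gB g(2) bounds[of x] by (auto simp: B_def)
    qed
    ultimately show ?thesis
      by (intro exI[of _ ?g]) blast
  qed auto
qed

section \<open>Patterns\<close>

lemma contains_pattern_Nil [simp]: "contains_pattern n \<sigma> []"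
  by (auto simp: contains_pattern_def strict_mono_on_def)

lemma contains_pattern_iff:
  "contains_pattern n \<sigma> \<pi> \<longleftrightarrow> (\<exists>idx. (\<forall>x y. x < y \<longrightarrow> y < length \<pi> \<longrightarrow> idx x < idx y) \<and>
     (\<forall>x<length \<pi>. idx x \<in> {1..n}) \<and>
     (\<forall>x<length \<pi>. \<forall>y<length \<pi>. \<sigma> (idx x) < \<sigma> (idx y) \<longleftrightarrow> \<pi> ! x < \<pi> ! y))"
proof -
  have "strict_mono_on {..<k} idx \<longleftrightarrow> (\<forall>x y. x < y \<longrightarrow> y < k \<longrightarrow> idx x < idx y)"
    for k :: nat and idx :: "nat \<Rightarrow> nat"
    by (auto simp: strict_mono_on_def)
  moreover have "idx ` {..<k} \<subseteq> {1..n} \<longleftrightarrow> (\<forall>x<k. idx x \<in> {1..n})" for k and idx :: "nat \<Rightarrow> nat"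
    by auto
  ultimately show ?thesis
    unfolding contains_pattern_def by simp
qed

text \<open>Listing the positions reduces the occurrence of a concrete pattern to inequalities between
  three or four positions and their values.\<close>

lemma contains_pattern_list:
  "contains_pattern n \<sigma> \<pi> \<longleftrightarrow> (\<exists>ps. length ps = length \<pi> \<and> sorted_wrt (<) ps \<and> set ps \<subseteq> {1..n} \<and>
     (\<forall>a<length \<pi>. \<forall>b<length \<pi>. \<sigma> (ps ! a) < \<sigma> (ps ! b) \<longleftrightarrow> \<pi> ! a < \<pi> ! b))"
    (is "?L \<longleftrightarrow> ?R")
proof
  assume ?L
  then obtain idx where "strict_mono_on {..<length \<pi>} idx" "idx ` {..<length \<pi>} \<subseteq> {1..n}"
    and "\<forall>a<length \<pi>. \<forall>b<length \<pi>. \<sigma> (idx a) < \<sigma> (idx b) \<longleftrightarrow> \<pi> ! a < \<pi> ! b"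
    unfolding contains_pattern_def by blast
  then show ?R
    by (intro exI[of _ "map idx [0..<length \<pi>]"])
      (auto simp: sorted_wrt_iff_nth_less strict_mono_on_def)
next
  assume ?R
  then obtain ps where ps: "length ps = length \<pi>" "sorted_wrt (<) ps" "set ps \<subseteq> {1..n}"
    "\<forall>a<length \<pi>. \<forall>b<length \<pi>. \<sigma> (ps ! a) < \<sigma> (ps ! b) \<longleftrightarrow> \<pi> ! a < \<pi> ! b"
    by blast
  have "strict_mono_on {..<length \<pi>} ((!) ps)"
    using ps(1,2) by (simp add: sorted_wrt_iff_nth_less strict_mono_on_def)
  moreover have "(!) ps ` {..<length \<pi>} \<subseteq> {1..n}"
    using ps(1,3) by (auto simp: set_conv_nth)
  ultimately show ?L
    unfolding contains_pattern_def using ps(4) by blast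
qed

lemma contains_pattern_3:
  "contains_pattern n \<sigma> [x, y, z] \<longleftrightarrow> (\<exists>i j k. 1 \<le> i \<and> i < j \<and> j < k \<and> k \<le> n \<and>
     (\<forall>a<3. \<forall>b<3. \<sigma> ([i, j, k] ! a) < \<sigma> ([i, j, k] ! b) \<longleftrightarrow> [x, y, z] ! a < [x, y, z] ! b))"
proof -
  have "length [x, y, z] = 3"
    by simp
  moreover have "(\<exists>ps. length ps = 3 \<and> P ps) \<longleftrightarrow> (\<exists>i j k. P [i, j, k])" for P :: "nat list \<Rightarrow> bool"
    by (simp add: numeral_3_eq_3 length_Suc_conv) blast
  moreover have "sorted_wrt (<) [i, j, k] \<and> set [i, j, k] \<subseteq> {1..n} \<and> Q \<longleftrightarrow>
      1 \<le> i \<and> i < j \<and> j < k \<and> k \<le> n \<and> Q" for i j k Q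
    by auto
  ultimately show ?thesis
    unfolding contains_pattern_list by (simp only:)
qed

lemma contains_pattern_4:
  "contains_pattern n \<sigma> [x, y, z, w] \<longleftrightarrow> (\<exists>i j k l. 1 \<le> i \<and> i < j \<and> j < k \<and> k < l \<and> l \<le> n \<and>
     (\<forall>a<4. \<forall>b<4. \<sigma> ([i, j, k, l] ! a) < \<sigma> ([i, j, k, l] ! b) \<longleftrightarrow>
                   [x, y, z, w] ! a < [x, y, z, w] ! b))"
proof -
  have "length [x, y, z, w] = 4"
    by simp
  moreover have "(\<exists>ps. length ps = 4 \<and> P ps) \<longleftrightarrow> (\<exists>i j k l. P [i, j, k, l])" for P :: "nat list \<Rightarrow> bool"
    by (simp add: eval_nat_numeral length_Suc_conv) blast
  moreover have "sorted_wrt (<) [i, j, k, l] \<and> set [i, j, k, l] \<subseteq> {1..n} \<and> Q \<longleftrightarrow>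
      1 \<le> i \<and> i < j \<and> j < k \<and> k < l \<and> l \<le> n \<and> Q" for i j k l Q
    by auto
  ultimately show ?thesis
    unfolding contains_pattern_list by (simp only:)
qed

lemma contains_321:
  "contains_pattern n \<sigma> [3, 2, 1] \<longleftrightarrow>
    (\<exists>i j k. 1 \<le> i \<and> i < j \<and> j < k \<and> k \<le> n \<and> \<sigma> k < \<sigma> j \<and> \<sigma> j < \<sigma> i)"
  unfolding contains_pattern_3
  by (intro iff_exI) (simp add: eval_nat_numeral All_less_Suc nth_Cons', linarith)

lemma contains_231:
  "contains_pattern n \<sigma> [2, 3, 1] \<longleftrightarrow>
    (\<exists>i j k. 1 \<le> i \<and> i < j \<and> j < k \<and> k \<le> n \<and> \<sigma> k < \<sigma> i \<and> \<sigma> i < \<sigma> j)"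
  unfolding contains_pattern_3
  by (intro iff_exI) (simp add: eval_nat_numeral All_less_Suc nth_Cons', linarith)

lemma contains_312:
  "contains_pattern n \<sigma> [3, 1, 2] \<longleftrightarrow>
    (\<exists>i j k. 1 \<le> i \<and> i < j \<and> j < k \<and> k \<le> n \<and> \<sigma> j < \<sigma> k \<and> \<sigma> k < \<sigma> i)"
  unfolding contains_pattern_3
  by (intro iff_exI) (simp add: eval_nat_numeral All_less_Suc nth_Cons', linarith)

lemma contains_4321:
  "contains_pattern n \<sigma> [4, 3, 2, 1] \<longleftrightarrow>
    (\<exists>i j k l. 1 \<le> i \<and> i < j \<and> j < k \<and> k < l \<and> l \<le> n \<and> \<sigma> l < \<sigma> k \<and> \<sigma> k < \<sigma> j \<and> \<sigma> j < \<sigma> i)"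
  unfolding contains_pattern_4
  by (intro iff_exI) (simp add: eval_nat_numeral All_less_Suc nth_Cons', linarith)

lemma contains_3412:
  "contains_pattern n \<sigma> [3, 4, 1, 2] \<longleftrightarrow>
    (\<exists>i j k l. 1 \<le> i \<and> i < j \<and> j < k \<and> k < l \<and> l \<le> n \<and> \<sigma> k < \<sigma> l \<and> \<sigma> l < \<sigma> i \<and> \<sigma> i < \<sigma> j)"
  unfolding contains_pattern_4
  by (intro iff_exI) (simp add: eval_nat_numeral All_less_Suc nth_Cons', linarith)

lemma contains_2143:
  "contains_pattern n \<sigma> [2, 1, 4, 3] \<longleftrightarrow>
    (\<exists>i j k l. 1 \<le> i \<and> i < j \<and> j < k \<and> k < l \<and> l \<le> n \<and> \<sigma> j < \<sigma> i \<and> \<sigma> i < \<sigma> l \<and> \<sigma> l < \<sigma> k)"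
  unfolding contains_pattern_4
  by (intro iff_exI) (simp add: eval_nat_numeral All_less_Suc nth_Cons', linarith)

lemma contains_1234:
  "contains_pattern n \<sigma> [1, 2, 3, 4] \<longleftrightarrow>
    (\<exists>i j k l. 1 \<le> i \<and> i < j \<and> j < k \<and> k < l \<and> l \<le> n \<and> \<sigma> i < \<sigma> j \<and> \<sigma> j < \<sigma> k \<and> \<sigma> k < \<sigma> l)"
  unfolding contains_pattern_4
  by (intro iff_exI) (simp add: eval_nat_numeral All_less_Suc nth_Cons', linarith)

text \<open>The positions of the occurrence are reflected, hence met in the opposite order.\<close>

lemma contains_pattern_reverse:
  assumes "contains_pattern n \<sigma> \<pi>" and \<sigma>': "\<And>i. i \<in> {1..n} \<Longrightarrow> \<sigma>' i = \<sigma> (n + 1 - i)"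
  shows "contains_pattern n \<sigma>' (rev \<pi>)"
proof -
  obtain idx where mono: "\<And>x y. x < y \<Longrightarrow> y < length \<pi> \<Longrightarrow> idx x < idx y"
    and range: "\<And>x. x < length \<pi> \<Longrightarrow> idx x \<in> {1..n}"
    and order: "\<And>x y. x < length \<pi> \<Longrightarrow> y < length \<pi> \<Longrightarrow> \<sigma> (idx x) < \<sigma> (idx y) \<longleftrightarrow> \<pi> ! x < \<pi> ! y"
    using assms(1) unfolding contains_pattern_iff by blast
  define idx' where "idx' x = n + 1 - idx (length \<pi> - Suc x)" for x
  have flip: "length \<pi> - Suc x < length \<pi>" if "x < length \<pi>" for x
    using that by simp
  have idx': "idx' x \<in> {1..n}" "\<sigma>' (idx' x) = \<sigma> (idx (length \<pi> - Suc x))" if "x < length \<pi>" for x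
  proof -
    show "idx' x \<in> {1..n}"
      using range[OF flip[OF that]] by (auto simp: idx'_def)
    then show "\<sigma>' (idx' x) = \<sigma> (idx (length \<pi> - Suc x))"
      using range[OF flip[OF that]] by (simp add: \<sigma>' idx'_def)
  qed
  have "idx' x < idx' y" if "x < y" "y < length \<pi>" for x y
  proof -
    have "idx (length \<pi> - Suc y) < idx (length \<pi> - Suc x)"
      using mono that by auto
    moreover have "idx (length \<pi> - Suc x) \<le> n"
      using range[OF flip[of x]] that by simp
    ultimately show ?thesis
      by (simp add: idx'_def)
  qed
  then show ?thesis
    unfolding contains_pattern_iff using idx' order
    by (intro exI[of _ idx']) (auto simp: rev_nth)
qed

section \<open>Direct sums\<close>

definition direct_sum :: "nat \<Rightarrow> (nat \<Rightarrow> nat) \<Rightarrow> (nat \<Rightarrow> nat) \<Rightarrow> nat \<Rightarrow> nat" where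
  "direct_sum a \<alpha> \<beta> i = (if i \<le> a then \<alpha> i else a + \<beta> (i - a))"

lemma direct_sum_closed:
  assumes "\<And>i. i \<in> {1..a} \<Longrightarrow> \<alpha> i \<in> {1..a}" "\<And>i. i \<in> {1..b} \<Longrightarrow> \<beta> i \<in> {1..b}" "i \<in> {1..a + b}"
  shows "direct_sum a \<alpha> \<beta> i \<in> {1..a + b}"
proof (cases "i \<le> a")
  case True
  then show ?thesis
    using assms(1)[of i] assms(3) by (auto simp: direct_sum_def)
next
  case False
  then have "i - a \<in> {1..b}"
    using assms(3) by auto
  with False show ?thesis
    using assms(2)[of "i - a"] by (auto simp: direct_sum_def)
qed

definition splits_at :: "nat list \<Rightarrow> nat \<Rightarrow> bool" where
  "splits_at \<pi> m \<longleftrightarrow> (\<forall>x<m. \<forall>y<length \<pi>. m \<le> y \<longrightarrow> \<pi> ! x < \<pi> ! y)"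

text \<open>The positions up to \<open>a\<close> in an occurrence form an initial segment of length \<open>m\<close>. All values
  of the left summand lie below all values of the right one, so the pattern has to split at \<open>m\<close>;
  conversely, occurrences of the two parts can be put side by side.\<close>

lemma contains_pattern_direct_sum:
  assumes \<alpha>: "\<And>i. i \<in> {1..a} \<Longrightarrow> \<alpha> i \<in> {1..a}" and \<beta>: "\<And>i. i \<in> {1..b} \<Longrightarrow> \<beta> i \<in> {1..b}"
  shows "contains_pattern (a + b) (direct_sum a \<alpha> \<beta>) \<pi> \<longleftrightarrow>
    (\<exists>m\<le>length \<pi>. splits_at \<pi> m \<and> contains_pattern a \<alpha> (take m \<pi>) \<and>
                   contains_pattern b \<beta> (drop m \<pi>))"
    (is "?L \<longleftrightarrow> ?R")
proof
  let ?k = "length \<pi>" and ?s = "direct_sum a \<alpha> \<beta>"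
  assume ?L
  then obtain idx where mono: "\<And>x y. x < y \<Longrightarrow> y < ?k \<Longrightarrow> idx x < idx y"
    and range: "\<And>x. x < ?k \<Longrightarrow> idx x \<in> {1..a + b}"
    and order: "\<And>x y. x < ?k \<Longrightarrow> y < ?k \<Longrightarrow> ?s (idx x) < ?s (idx y) \<longleftrightarrow> \<pi> ! x < \<pi> ! y"
    unfolding contains_pattern_iff by blast
  \<comment> \<open>The first letter placed in the right summand, or \<open>?k\<close> if all lie in the left one.\<close>
  define m where "m = (LEAST m. m = ?k \<or> a < idx m)"
  have m: "m = ?k \<or> a < idx m"
    unfolding m_def by (rule LeastI[of _ ?k]) simp
  have "m \<le> ?k"
    unfolding m_def by (rule Least_le) simp
  have low: "idx x \<le> a" if "x < m" for x
    using not_less_Least[of x "\<lambda>m. m = ?k \<or> a < idx m"] that by (auto simp: m_def[symmetric])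
  have high: "a < idx x" if "m \<le> x" "x < ?k" for x
    using m mono[of m x] that by (cases "x = m") auto
  have low_val: "?s (idx x) = \<alpha> (idx x) \<and> \<alpha> (idx x) \<in> {1..a}" if "x < m" for x
    using low[OF that] range[of x] that \<open>m \<le> ?k\<close> \<alpha>[of "idx x"] by (auto simp: direct_sum_def)
  have high_val: "?s (idx x) = a + \<beta> (idx x - a) \<and> \<beta> (idx x - a) \<in> {1..b}" if "m \<le> x" "x < ?k" for x
  proof -
    have "idx x - a \<in> {1..b}"
      using high[OF that] range[of x] that by auto
    then show ?thesis
      using high[OF that] \<beta> by (simp add: direct_sum_def)
  qed
  have "splits_at \<pi> m"
    unfolding splits_at_def
  proof (intro allI impI)
    fix x y assume "x < m" "y < ?k" "m \<le> y"
    then show "\<pi> ! x < \<pi> ! y"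
      using order[of x y] low_val[of x] high_val[of y] \<open>m \<le> ?k\<close> by auto
  qed
  moreover have "contains_pattern a \<alpha> (take m \<pi>)"
    unfolding contains_pattern_def
  proof (intro exI[of _ idx] conjI allI impI)
    show "strict_mono_on {..<length (take m \<pi>)} idx"
      using mono by (auto simp: strict_mono_on_def)
    show "idx ` {..<length (take m \<pi>)} \<subseteq> {1..a}"
      using range low \<open>m \<le> ?k\<close> by fastforce
    show "\<alpha> (idx x) < \<alpha> (idx y) \<longleftrightarrow> take m \<pi> ! x < take m \<pi> ! y"
      if "x < length (take m \<pi>)" "y < length (take m \<pi>)" for x y
      using order[of x y] low_val[of x] low_val[of y] that by auto
  qed
  moreover have "contains_pattern b \<beta> (drop m \<pi>)"
    unfolding contains_pattern_def
  proof (intro exI[of _ "\<lambda>x. idx (m + x) - a"] conjI allI impI)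
    show "strict_mono_on {..<length (drop m \<pi>)} (\<lambda>x. idx (m + x) - a)"
      using mono high by (fastforce simp: strict_mono_on_def intro!: diff_less_mono less_imp_le)
    show "(\<lambda>x. idx (m + x) - a) ` {..<length (drop m \<pi>)} \<subseteq> {1..b}"
    proof (intro subsetI, elim imageE)
      fix z x assume "x \<in> {..<length (drop m \<pi>)}" "z = idx (m + x) - a"
      moreover from this have "m + x < ?k"
        by simp
      ultimately show "z \<in> {1..b}"
        using range[of "m + x"] high[of "m + x"] by auto
    qed
    show "\<beta> (idx (m + x) - a) < \<beta> (idx (m + y) - a) \<longleftrightarrow> drop m \<pi> ! x < drop m \<pi> ! y"
      if "x < length (drop m \<pi>)" "y < length (drop m \<pi>)" for x y
      using order[of "m + x" "m + y"] high_val[of "m + x"] high_val[of "m + y"] that \<open>m \<le> ?k\<close> by auto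
  qed
  ultimately show ?R
    using \<open>m \<le> ?k\<close> by blast
next
  let ?k = "length \<pi>" and ?s = "direct_sum a \<alpha> \<beta>"
  assume ?R
  then obtain m where m: "m \<le> ?k" "splits_at \<pi> m"
    and left: "contains_pattern a \<alpha> (take m \<pi>)" and right: "contains_pattern b \<beta> (drop m \<pi>)"
    by blast
  from left obtain f where f: "\<And>x y. x < y \<Longrightarrow> y < m \<Longrightarrow> f x < f y" "\<And>x. x < m \<Longrightarrow> f x \<in> {1..a}"
      "\<And>x y. x < m \<Longrightarrow> y < m \<Longrightarrow> \<alpha> (f x) < \<alpha> (f y) \<longleftrightarrow> \<pi> ! x < \<pi> ! y"
    unfolding contains_pattern_iff using \<open>m \<le> ?k\<close> by (simp add: min_absorb2) blast
  from right obtain g where g: "\<And>x y. x < y \<Longrightarrow> y < ?k - m \<Longrightarrow> g x < g y" "\<And>x. x < ?k - m \<Longrightarrow> g x \<in> {1..b}"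
      "\<And>x y. x < ?k - m \<Longrightarrow> y < ?k - m \<Longrightarrow> \<beta> (g x) < \<beta> (g y) \<longleftrightarrow> \<pi> ! (m + x) < \<pi> ! (m + y)"
    unfolding contains_pattern_iff using \<open>m \<le> ?k\<close> by simp blast
  define idx where "idx x = (if x < m then f x else a + g (x - m))" for x
  have low: "idx x \<in> {1..a} \<and> ?s (idx x) = \<alpha> (f x) \<and> \<alpha> (f x) \<in> {1..a}" if "x < m" for x
    using f(2)[OF that] \<alpha>[of "f x"] that by (auto simp: idx_def direct_sum_def)
  have high: "idx x \<in> {a + 1..a + b} \<and> ?s (idx x) = a + \<beta> (g (x - m)) \<and> \<beta> (g (x - m)) \<in> {1..b}"
    if "m \<le> x" "x < ?k" for x
  proof -
    have "g (x - m) \<in> {1..b}" "\<beta> (g (x - m)) \<in> {1..b}"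
      using g(2)[of "x - m"] \<beta> that by auto
    then show ?thesis
      using that by (auto simp: idx_def direct_sum_def)
  qed
  show ?L
    unfolding contains_pattern_def
  proof (intro exI[of _ idx] conjI allI impI)
    have "idx x < idx y" if "x < y" "y < ?k" for x y
      using f(1)[of x y] g(1)[of "x - m" "y - m"] low[of x] high[of y] that
      by (cases "x < m"; cases "y < m") (auto simp: idx_def)
    then show "strict_mono_on {..<?k} idx"
      by (auto simp: strict_mono_on_def)
    show "idx ` {..<?k} \<subseteq> {1..a + b}"
    proof (intro subsetI, elim imageE)
      fix z x assume "z = idx x" "x \<in> {..<?k}"
      then show "z \<in> {1..a + b}"
        using low[of x] high[of x] by (cases "x < m") auto
    qed
    fix x y assume xy: "x < ?k" "y < ?k"
    consider "x < m" "y < m" | "x < m" "m \<le> y" | "m \<le> x" "y < m" | "m \<le> x" "m \<le> y"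
      by linarith
    then show "?s (idx x) < ?s (idx y) \<longleftrightarrow> \<pi> ! x < \<pi> ! y"
    proof cases
      case 1
      then show ?thesis using low[of x] low[of y] f(3) by auto
    next
      case 2
      then have "\<pi> ! x < \<pi> ! y"
        using m(2) xy by (auto simp: splits_at_def)
      then show ?thesis using low[of x] high[of y] xy 2 by auto
    next
      case 3
      then have "\<pi> ! y < \<pi> ! x"
        using m(2) xy by (auto simp: splits_at_def)
      then show ?thesis using low[of y] high[of x] xy 3 by auto
    next
      case 4
      then show ?thesis using high[of x] high[of y] xy g(3)[of "x - m" "y - m"] by auto
    qed
  qed
qed

section \<open>Centrosymmetric involutions\<close>

lemma centrosymmetric_involutions_iff:
  "\<tau> \<in> centrosymmetric_involutions n \<longleftrightarrow> (\<forall>i. i \<notin> {1..n} \<longrightarrow> \<tau> i = i) \<and>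
     (\<forall>i\<in>{1..n}. \<tau> i \<in> {1..n} \<and> \<tau> (\<tau> i) = i \<and> \<tau> (n + 1 - i) = n + 1 - \<tau> i)"
    (is "?L \<longleftrightarrow> ?R")
proof
  assume ?L
  then have \<tau>: "\<tau> permutes {1..n}" "\<tau> \<circ> \<tau> = id" "\<forall>i\<in>{1..n}. \<tau> i + \<tau> (n + 1 - i) = n + 1"
    by (auto simp: centrosymmetric_involutions_def)
  have "\<tau> (\<tau> i) = i" for i
    using \<tau>(2) by (metis comp_apply id_apply)
  moreover have "\<tau> i \<in> {1..n}" if "i \<in> {1..n}" for i
    using \<tau>(1) that by (simp only: permutes_in_image)
  moreover have "\<tau> (n + 1 - i) = n + 1 - \<tau> i" if "i \<in> {1..n}" for i
    using \<tau>(3) that by (metis diff_add_inverse)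
  ultimately show ?R
    using permutes_not_in[OF \<tau>(1)] by blast
next
  assume R: ?R
  have invol: "\<tau> (\<tau> i) = i" for i
    using R by (cases "i \<in> {1..n}") auto
  have "bij_betw \<tau> {1..n} {1..n}"
    using R by (intro bij_betw_byWitness[of _ \<tau>]) auto
  then have "\<tau> permutes {1..n}"
    using R by (intro bij_imp_permutes) auto
  moreover have "\<tau> \<circ> \<tau> = id"
    using invol by auto
  moreover have "\<tau> i + \<tau> (n + 1 - i) = n + 1" if "i \<in> {1..n}" for i
  proof -
    have "\<tau> i \<in> {1..n}" "\<tau> (n + 1 - i) = n + 1 - \<tau> i"
      using R that by blast+
    then show ?thesis by simp
  qed
  ultimately show ?L
    by (auto simp: centrosymmetric_involutions_def)
qed

context
  fixes \<tau> n
  assumes \<tau>: "\<tau> \<in> centrosymmetric_involutions n"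
begin

lemma ci_fixes_outside: "i \<notin> {1..n} \<Longrightarrow> \<tau> i = i"
  using \<tau> by (auto simp: centrosymmetric_involutions_iff)

lemma ci_invol: "\<tau> (\<tau> i) = i"
  using \<tau> by (cases "i \<in> {1..n}") (auto simp: centrosymmetric_involutions_iff)

lemma ci_closed: "i \<in> {1..n} \<Longrightarrow> \<tau> i \<in> {1..n}"
  using \<tau> by (auto simp: centrosymmetric_involutions_iff)

lemma ci_bounds: "1 \<le> i \<Longrightarrow> i \<le> n \<Longrightarrow> 1 \<le> \<tau> i \<and> \<tau> i \<le> n"
  using ci_closed[of i] by auto

lemma ci_mirror: "i \<in> {1..n} \<Longrightarrow> \<tau> (n + 1 - i) = n + 1 - \<tau> i"
  using \<tau> by (auto simp: centrosymmetric_involutions_iff)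

lemma ci_eq_iff: "\<tau> i = \<tau> j \<longleftrightarrow> i = j"
  by (metis ci_invol)

end

lemma finite_CI [simp]: "finite (CI n P)"
proof -
  have "CI n P \<subseteq> {\<tau>. \<tau> permutes {1..n}}"
    by (auto simp: CI_def centrosymmetric_involutions_def)
  then show ?thesis
    using finite_permutations[of "{1..n}"] finite_subset by blast
qed

lemma CI_0:
  assumes "[] \<notin> P"
  shows "CI 0 P = {id}"
proof -
  have "centrosymmetric_involutions 0 = {id}"
    by (auto simp: centrosymmetric_involutions_iff)
  moreover have "\<not> contains_pattern 0 \<sigma> \<pi>" if "\<pi> \<in> P" for \<sigma> \<pi>
    using assms that by (cases \<pi>) (auto simp: contains_pattern_list)
  ultimately show ?thesis
    by (auto simp: CI_def)
qed

definition flip :: "nat \<Rightarrow> nat \<Rightarrow> nat" where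
  "flip n i = (if i \<in> {1..n} then n + 1 - i else i)"

lemma flip_ci: "flip n \<in> centrosymmetric_involutions n"
  by (auto simp: centrosymmetric_involutions_iff flip_def)

text \<open>Every choice of positions in a decreasing permutation gives a decreasing sequence.\<close>

lemma contains_pattern_flip:
  "contains_pattern n (flip n) \<pi> \<longleftrightarrow> length \<pi> \<le> n \<and> sorted_wrt (>) \<pi>"
proof
  assume "contains_pattern n (flip n) \<pi>"
  then obtain ps where ps: "length ps = length \<pi>" "sorted_wrt (<) ps" "set ps \<subseteq> {1..n}"
    "\<forall>a<length \<pi>. \<forall>b<length \<pi>. flip n (ps ! a) < flip n (ps ! b) \<longleftrightarrow> \<pi> ! a < \<pi> ! b"
    unfolding contains_pattern_list by blast
  have "distinct ps"
    using ps(2) by (simp add: strict_sorted_iff)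
  then have "length \<pi> \<le> n"
    using card_mono[OF _ ps(3)] ps(1) by (simp add: distinct_card)
  moreover have "\<pi> ! b < \<pi> ! a" if "a < b" "b < length \<pi>" for a b
  proof -
    have "ps ! a \<in> {1..n}" "ps ! b \<in> {1..n}"
      using ps(1,3) that by (metis nth_mem order.strict_trans subsetD)+
    moreover have "ps ! a < ps ! b"
      using ps(1,2) that by (simp add: sorted_wrt_iff_nth_less)
    ultimately have "flip n (ps ! b) < flip n (ps ! a)"
      by (auto simp: flip_def)
    then show ?thesis
      using ps(4) that by auto
  qed
  ultimately show "length \<pi> \<le> n \<and> sorted_wrt (>) \<pi>"
    by (simp add: sorted_wrt_iff_nth_less)
next
  assume \<pi>: "length \<pi> \<le> n \<and> sorted_wrt (>) \<pi>"
  then have "\<pi> ! a < \<pi> ! b \<longleftrightarrow> b < a" if "a < length \<pi>" "b < length \<pi>" for a b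
    using that by (metis linorder_neqE_nat order_less_asym sorted_wrt_nth_less)
  with \<pi> show "contains_pattern n (flip n) \<pi>"
    unfolding contains_pattern_iff by (intro exI[of _ Suc]) (auto simp: flip_def)
qed

lemma increasing_in_flip:
  "contains_pattern n (flip n) \<pi> \<Longrightarrow> sorted_wrt (<) \<pi> \<Longrightarrow> length \<pi> \<le> 1"
  by (cases \<pi>; cases "tl \<pi>") (auto simp: contains_pattern_flip)

text \<open>Composition with \<open>flip n\<close> is its own inverse. It keeps involutions involutive because they
  commute with \<open>flip n\<close>, and it reverses all patterns.\<close>

lemma card_CI_reverse: "card (CI n P) = card (CI n (rev ` P))"
proof (rule bij_betw_same_card)
  let ?R = "\<lambda>\<tau>. \<tau> \<circ> flip n"
  have flip: "flip n (flip n i) = i" for i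
    by (auto simp: flip_def)
  have R_CI: "?R \<tau> \<in> CI n (rev ` Q)" if "\<tau> \<in> CI n Q" for \<tau> Q
  proof -
    have \<tau>: "\<tau> \<in> centrosymmetric_involutions n" and avoid: "\<And>\<pi>. \<pi> \<in> Q \<Longrightarrow> \<not> contains_pattern n \<tau> \<pi>"
      using that by (auto simp: CI_def)
    have R: "?R \<tau> i = \<tau> (n + 1 - i)" "?R \<tau> i = n + 1 - \<tau> i" if "i \<in> {1..n}" for i
      using that ci_mirror[OF \<tau> that] by (auto simp: flip_def)
    have "?R \<tau> \<in> centrosymmetric_involutions n"
      unfolding centrosymmetric_involutions_iff
    proof (intro conjI allI impI ballI)
      fix i assume i: "i \<in> {1..n}"
      then have j: "n + 1 - i \<in> {1..n}"
        by auto
      show closed: "?R \<tau> i \<in> {1..n}"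
        using R(1)[OF i] ci_closed[OF \<tau> j] by simp
      have "?R \<tau> (?R \<tau> i) = n + 1 - \<tau> (\<tau> (n + 1 - i))"
        unfolding R(2)[OF closed] unfolding R(1)[OF i] ..
      also have "\<dots> = i"
        using i by (simp add: ci_invol[OF \<tau>])
      finally show "?R \<tau> (?R \<tau> i) = i" .
      show "?R \<tau> (n + 1 - i) = n + 1 - ?R \<tau> i"
        using R(2)[OF j] R(1)[OF i] by simp
    qed (use ci_fixes_outside[OF \<tau>] in \<open>auto simp: flip_def\<close>)
    moreover have "\<not> contains_pattern n (?R \<tau>) (rev \<pi>)" if "\<pi> \<in> Q" for \<pi>
    proof
      assume "contains_pattern n (?R \<tau>) (rev \<pi>)"
      then have "contains_pattern n \<tau> (rev (rev \<pi>))"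
        by (rule contains_pattern_reverse) (auto simp: flip_def)
      with avoid that show False by simp
    qed
    ultimately show ?thesis
      by (auto simp: CI_def)
  qed
  have rev_rev: "rev ` rev ` P = P"
    by (simp add: image_image)
  show "bij_betw ?R (CI n P) (CI n (rev ` P))"
    using R_CI[of _ P] R_CI[of _ "rev ` P"] unfolding rev_rev
    by (intro bij_betw_byWitness[of _ ?R]) (auto simp: fun_eq_iff flip)
qed

text \<open>The pattern 312 is the inverse of 231, and an involution maps the positions of an
  occurrence to positions of an occurrence of the inverse pattern.\<close>

lemma ci_contains_231_iff:
  assumes \<tau>: "\<tau> \<in> centrosymmetric_involutions n"
  shows "contains_pattern n \<tau> [2, 3, 1] \<longleftrightarrow> contains_pattern n \<tau> [3, 1, 2]"
proof
  assume "contains_pattern n \<tau> [2, 3, 1]"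
  then obtain i j k where "1 \<le> i" "i < j" "j < k" "k \<le> n" "\<tau> k < \<tau> i" "\<tau> i < \<tau> j"
    unfolding contains_231 by blast
  then show "contains_pattern n \<tau> [3, 1, 2]"
    unfolding contains_312 using ci_bounds[OF \<tau>, of k] ci_bounds[OF \<tau>, of j]
    by (intro exI[of _ "\<tau> k"] exI[of _ "\<tau> i"] exI[of _ "\<tau> j"]) (simp add: ci_invol[OF \<tau>])
next
  assume "contains_pattern n \<tau> [3, 1, 2]"
  then obtain i j k where "1 \<le> i" "i < j" "j < k" "k \<le> n" "\<tau> j < \<tau> k" "\<tau> k < \<tau> i"
    unfolding contains_312 by blast
  then show "contains_pattern n \<tau> [2, 3, 1]"
    unfolding contains_231 using ci_bounds[OF \<tau>, of j] ci_bounds[OF \<tau>, of i]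
    by (intro exI[of _ "\<tau> j"] exI[of _ "\<tau> k"] exI[of _ "\<tau> i"]) (simp add: ci_invol[OF \<tau>])
qed

section \<open>Palindromic direct sums\<close>

definition sum_indecomposable :: "nat list \<Rightarrow> bool" where
  "sum_indecomposable \<pi> \<longleftrightarrow> \<pi> \<noteq> [] \<and> (\<forall>m. 0 < m \<longrightarrow> m < length \<pi> \<longrightarrow> \<not> splits_at \<pi> m)"

text \<open>The only splits of the pattern are the trivial ones at its two ends.\<close>

lemma contains_direct_sum_indecomposable:
  assumes "sum_indecomposable \<pi>" and "\<And>i. i \<in> {1..a} \<Longrightarrow> \<alpha> i \<in> {1..a}"
    and "\<And>i. i \<in> {1..b} \<Longrightarrow> \<beta> i \<in> {1..b}"
  shows "contains_pattern (a + b) (direct_sum a \<alpha> \<beta>) \<pi> \<longleftrightarrow>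
    contains_pattern a \<alpha> \<pi> \<or> contains_pattern b \<beta> \<pi>"
proof -
  have cut: "m = 0 \<or> m = length \<pi>" if "splits_at \<pi> m" "m \<le> length \<pi>" for m
    using assms(1) that by (auto simp: sum_indecomposable_def)
  have trivial: "splits_at \<pi> 0" "splits_at \<pi> (length \<pi>)"
    by (auto simp: splits_at_def)
  have iff: "contains_pattern (a + b) (direct_sum a \<alpha> \<beta>) \<pi> \<longleftrightarrow>
      (\<exists>m\<le>length \<pi>. splits_at \<pi> m \<and> contains_pattern a \<alpha> (take m \<pi>) \<and>
                     contains_pattern b \<beta> (drop m \<pi>))"
    using assms(2,3) by (rule contains_pattern_direct_sum)
  show ?thesis
  proof
    assume "contains_pattern (a + b) (direct_sum a \<alpha> \<beta>) \<pi>"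
    then obtain m where m: "m \<le> length \<pi>" "splits_at \<pi> m"
      "contains_pattern a \<alpha> (take m \<pi>)" "contains_pattern b \<beta> (drop m \<pi>)"
      unfolding iff by blast
    then show "contains_pattern a \<alpha> \<pi> \<or> contains_pattern b \<beta> \<pi>"
      using cut[OF m(2,1)] by auto
  next
    assume "contains_pattern a \<alpha> \<pi> \<or> contains_pattern b \<beta> \<pi>"
    then show "contains_pattern (a + b) (direct_sum a \<alpha> \<beta>) \<pi>"
      unfolding iff using trivial
      by (elim disjE) (auto intro: exI[of _ "length \<pi>"] exI[of _ 0])
  qed
qed

text \<open>The direct sum \<open>\<beta> \<oplus> \<tau> \<oplus> \<beta>\<close>. In a centrosymmetric sum the last summand is the first one rotated
  by half a turn, which is \<open>\<beta>\<close> again as \<open>\<beta>\<close> is centrosymmetric.\<close>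

definition sandwich :: "(nat \<Rightarrow> nat) \<Rightarrow> nat \<Rightarrow> nat \<Rightarrow> (nat \<Rightarrow> nat) \<Rightarrow> nat \<Rightarrow> nat" where
  "sandwich \<beta> j m \<tau> = direct_sum j \<beta> (direct_sum m \<tau> \<beta>)"

lemma sandwich_left: "i \<le> j \<Longrightarrow> sandwich \<beta> j m \<tau> i = \<beta> i"
  by (simp add: sandwich_def direct_sum_def)

lemma sandwich_middle: "1 \<le> i \<Longrightarrow> i \<le> m \<Longrightarrow> sandwich \<beta> j m \<tau> (j + i) = j + \<tau> i"
  by (simp add: sandwich_def direct_sum_def)

lemma sandwich_right: "1 \<le> i \<Longrightarrow> sandwich \<beta> j m \<tau> (j + m + i) = j + m + \<beta> i"
  by (simp add: sandwich_def direct_sum_def)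

lemma sandwich_ci:
  assumes \<beta>: "\<beta> \<in> centrosymmetric_involutions j" and \<tau>: "\<tau> \<in> centrosymmetric_involutions m"
  shows "sandwich \<beta> j m \<tau> \<in> centrosymmetric_involutions (2 * j + m)"
  unfolding centrosymmetric_involutions_iff
proof (intro conjI allI impI ballI)
  let ?s = "sandwich \<beta> j m \<tau>" and ?n = "2 * j + m"
  fix i assume "i \<notin> {1..?n}"
  then consider "i = 0" | "?n < i" "i - j - m \<notin> {1..j}" "i \<notin> {1..j}"
    by fastforce
  then show "?s i = i"
    using ci_fixes_outside[OF \<beta>] by cases (auto simp: sandwich_def direct_sum_def)
next
  let ?s = "sandwich \<beta> j m \<tau>" and ?n = "2 * j + m"
  fix i assume i: "i \<in> {1..?n}"
  consider (left) "i \<in> {1..j}" | (middle) k where "i = j + k" "k \<in> {1..m}"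
    | (right) k where "i = j + m + k" "k \<in> {1..j}"
  proof -
    have "i \<in> {1..j} \<or> (i = j + (i - j) \<and> i - j \<in> {1..m}) \<or>
        (i = j + m + (i - j - m) \<and> i - j - m \<in> {1..j})"
      using i by auto
    then show ?thesis using that by blast
  qed
  then have "?s i \<in> {1..?n} \<and> ?s (?s i) = i \<and> ?s (?n + 1 - i) = ?n + 1 - ?s i"
  proof cases
    case left
    have "?n + 1 - i = j + m + (j + 1 - i)" "1 \<le> j + 1 - i"
      using left by auto
    then have "?s (?n + 1 - i) = j + m + (j + 1 - \<beta> i)"
      using left ci_mirror[OF \<beta> left] sandwich_right[of "j + 1 - i" \<beta> j m \<tau>] by simp
    then show ?thesis
      using left ci_closed[OF \<beta> left] ci_invol[OF \<beta>] by (auto simp: sandwich_left)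
  next
    case middle
    have "?n + 1 - i = j + (m + 1 - k)" "1 \<le> m + 1 - k" "m + 1 - k \<le> m"
      using middle by auto
    then have "?s (?n + 1 - i) = j + (m + 1 - \<tau> k)"
      using middle ci_mirror[OF \<tau> middle(2)] sandwich_middle[of "m + 1 - k" m \<beta> j \<tau>] by simp
    then show ?thesis
      using middle ci_closed[OF \<tau> middle(2)] ci_invol[OF \<tau>] by (auto simp: sandwich_middle)
  next
    case right
    have "?n + 1 - i = j + 1 - k" "j + 1 - k \<le> j"
      using right by auto
    then have "?s (?n + 1 - i) = j + 1 - \<beta> k"
      using right ci_mirror[OF \<beta> right(2)] sandwich_left[of "j + 1 - k" j \<beta> m \<tau>] by simp
    then show ?thesis
      using right ci_closed[OF \<beta> right(2)] ci_invol[OF \<beta>] by (auto simp: sandwich_right)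
  qed
  then show "?s i \<in> {1..?n}" "?s (?s i) = i" "?s (?n + 1 - i) = ?n + 1 - ?s i"
    by blast+
qed

text \<open>For patterns that may spread over several of the three summands.\<close>

lemma contains_sandwich:
  assumes \<beta>: "\<beta> \<in> centrosymmetric_involutions j" and \<tau>: "\<tau> \<in> centrosymmetric_involutions m"
  shows "contains_pattern (2 * j + m) (sandwich \<beta> j m \<tau>) \<pi> \<longleftrightarrow>
    (\<exists>p\<le>length \<pi>. splits_at \<pi> p \<and> contains_pattern j \<beta> (take p \<pi>) \<and>
      (\<exists>q\<le>length \<pi> - p. splits_at (drop p \<pi>) q \<and> contains_pattern m \<tau> (take q (drop p \<pi>)) \<and>
        contains_pattern j \<beta> (drop (p + q) \<pi>)))"
proof -
  have eq: "2 * j + m = j + (m + j)"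
    by simp
  show ?thesis
    unfolding sandwich_def eq
    using contains_pattern_direct_sum[of j \<beta> "m + j" "direct_sum m \<tau> \<beta>" \<pi>]
      contains_pattern_direct_sum[of m \<tau> j \<beta>] direct_sum_closed[of m \<tau> j \<beta>]
      ci_closed[OF \<beta>] ci_closed[OF \<tau>]
    by (simp add: add.commute[of _ p for p])
qed

lemma contains_sandwich_middle:
  assumes "\<beta> \<in> centrosymmetric_involutions j" "\<tau> \<in> centrosymmetric_involutions m"
    and "contains_pattern m \<tau> \<pi>"
  shows "contains_pattern (2 * j + m) (sandwich \<beta> j m \<tau>) \<pi>"
  unfolding contains_sandwich[OF assms(1,2)]
  using assms(3) by (intro exI[of _ 0] conjI exI[of _ "length \<pi>"]) (auto simp: splits_at_def)

lemma contains_sandwich_indecomposable: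
  assumes "sum_indecomposable \<pi>" and \<beta>: "\<beta> \<in> centrosymmetric_involutions j"
    and \<tau>: "\<tau> \<in> centrosymmetric_involutions m"
  shows "contains_pattern (2 * j + m) (sandwich \<beta> j m \<tau>) \<pi> \<longleftrightarrow>
    contains_pattern j \<beta> \<pi> \<or> contains_pattern m \<tau> \<pi>"
proof -
  have "contains_pattern (j + (m + j)) (sandwich \<beta> j m \<tau>) \<pi> \<longleftrightarrow>
      contains_pattern j \<beta> \<pi> \<or> contains_pattern (m + j) (direct_sum m \<tau> \<beta>) \<pi>"
    unfolding sandwich_def
    by (intro contains_direct_sum_indecomposable[OF assms(1)] direct_sum_closed
        ci_closed[OF \<beta>] ci_closed[OF \<tau>])
  also have "contains_pattern (m + j) (direct_sum m \<tau> \<beta>) \<pi> \<longleftrightarrow>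
      contains_pattern m \<tau> \<pi> \<or> contains_pattern j \<beta> \<pi>"
    by (intro contains_direct_sum_indecomposable[OF assms(1)] ci_closed[OF \<beta>] ci_closed[OF \<tau>])
  finally show ?thesis
    by (subst mult_2, subst add.assoc, subst add.commute[of j m]) blast
qed

lemma sandwich_inject:
  assumes "\<tau> \<in> centrosymmetric_involutions m" "\<tau>' \<in> centrosymmetric_involutions m"
    and eq: "sandwich \<beta> j m \<tau> = sandwich \<beta> j m \<tau>'"
  shows "\<tau> = \<tau>'"
proof
  fix i
  show "\<tau> i = \<tau>' i"
  proof (cases "i \<in> {1..m}")
    case True
    then show ?thesis
      using fun_cong[OF eq, of "j + i"] by (simp add: sandwich_middle)
  qed (use assms(1,2) ci_fixes_outside in metis)
qed

text \<open>If \<open>\<tau> 1 < n\<close>, then \<open>n + 1 - \<tau> 1\<close> is sent to \<open>n\<close> and so lies outside of the invariant interval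
  \<open>{1..\<tau> 1}\<close>. Thus this interval is disjoint from its mirror image, and \<open>\<tau>\<close> permutes what lies
  between the two.\<close>

lemma ci_first_block:
  assumes \<tau>: "\<tau> \<in> centrosymmetric_involutions n" and n: "1 \<le> n"
    and \<beta>: "\<beta> \<in> centrosymmetric_involutions (\<tau> 1)"
    and block: "\<And>i. i \<in> {1..\<tau> 1} \<Longrightarrow> \<tau> i = \<beta> i"
  shows "(\<tau> 1 = n \<and> \<tau> = \<beta>) \<or> (\<tau> 1 \<in> {1..n div 2} \<and>
    (\<exists>\<tau>' \<in> centrosymmetric_involutions (n - 2 * \<tau> 1). \<tau> = sandwich \<beta> (\<tau> 1) (n - 2 * \<tau> 1) \<tau>'))"
proof -
  define j where "j = \<tau> 1"
  note \<beta> = \<beta>[folded j_def] and block = block[folded j_def]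
  have j: "1 \<le> j" "j \<le> n"
    using ci_bounds[OF \<tau>, of 1] n by (auto simp: j_def)
  have below: "\<tau> i \<le> j \<longleftrightarrow> i \<le> j" if "1 \<le> i" "i \<le> n" for i
  proof -
    have low: "\<tau> k \<le> j" if "k \<in> {1..j}" for k
      using block[OF that] ci_closed[OF \<beta> that] by simp
    show ?thesis
      using low[of i] low[of "\<tau> i"] ci_bounds[OF \<tau> that] ci_invol[OF \<tau>, of i] that by auto
  qed
  show ?thesis
  proof (cases "j = n")
    case True
    have "\<tau> i = \<beta> i" for i
      using block[of i] ci_fixes_outside[OF \<tau>, of i] ci_fixes_outside[OF \<beta>, of i] True
      by (cases "i \<in> {1..n}") auto
    with True show ?thesis
      by (auto simp: j_def)
  next
    case False
    have "\<tau> (n + 1 - j) = n"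
      using ci_mirror[OF \<tau>, of j] ci_invol[OF \<tau>, of 1] j by (simp add: j_def)
    then have double: "2 * j \<le> n"
      using below[of "n + 1 - j"] j False by (simp add: not_le) linarith
    define m \<tau>' where "m = n - 2 * j" and "\<tau>' i = (if i \<in> {1..m} then \<tau> (j + i) - j else i)" for i
    have n_eq: "n = 2 * j + m"
      using double by (simp add: m_def)
    have mid: "\<tau> (j + i) = j + \<tau>' i \<and> \<tau>' i \<in> {1..m}" if "i \<in> {1..m}" for i
    proof -
      let ?k = "n + 1 - (j + i)"
      have "\<tau> ?k = n + 1 - \<tau> (j + i)"
        using that by (intro ci_mirror[OF \<tau>]) (simp add: n_eq)
      moreover have "1 \<le> ?k" "?k \<le> n" "j < ?k" "1 \<le> j + i" "j + i \<le> n" "j < j + i"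
        using that by (auto simp: n_eq)
      then have "j < \<tau> ?k" "j < \<tau> (j + i)"
        using below by (metis not_le)+
      ultimately show ?thesis
        using that by (auto simp: \<tau>'_def n_eq)
    qed
    have "\<tau>' \<in> centrosymmetric_involutions m"
      unfolding centrosymmetric_involutions_iff
    proof (intro conjI allI impI ballI)
      fix i assume i: "i \<in> {1..m}"
      show "\<tau>' i \<in> {1..m}"
        using mid[OF i] by simp
      then show "\<tau>' (\<tau>' i) = i"
        using mid[OF i] mid[of "\<tau>' i"] ci_invol[OF \<tau>, of "j + i"] by simp
      have "m + 1 - i \<in> {1..m}" "j + (m + 1 - i) = n + 1 - (j + i)" "j + i \<in> {1..n}"
        using i by (auto simp: n_eq)
      then show "\<tau>' (m + 1 - i) = m + 1 - \<tau>' i"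
        using mid[OF i] mid[of "m + 1 - i"] ci_mirror[OF \<tau>, of "j + i"] by (auto simp: n_eq)
    qed (auto simp: \<tau>'_def)
    moreover have "\<tau> = sandwich \<beta> j m \<tau>'"
    proof
      fix i
      consider "i = 0" | "i \<in> {1..j}" | "j < i" "i \<le> j + m" | "j + m < i" "i \<le> n" | "n < i"
        unfolding atLeastAtMost_iff by linarith
      then show "\<tau> i = sandwich \<beta> j m \<tau>' i"
      proof cases
        case 1
        then show ?thesis
          using ci_fixes_outside[OF \<tau>, of 0] ci_fixes_outside[OF \<beta>, of 0] by (simp add: sandwich_left)
      next
        case 2
        then show ?thesis
          using block by (simp add: sandwich_left)
      next
        case 3
        then obtain k where "i = j + k" "k \<in> {1..m}"
          by (intro that[of "i - j"]) auto
        then show ?thesis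
          using mid[of k] by (simp add: sandwich_middle)
      next
        case 4
        then obtain k where k: "i = j + m + k" "k \<in> {1..j}"
          by (intro that[of "i - (j + m)"]) (auto simp: n_eq)
        then have k': "j + 1 - k \<in> {1..j}"
          by auto
        have "j + 1 - k \<in> {1..n}" "n + 1 - (j + 1 - k) = i"
          using k by (auto simp: n_eq)
        then have "\<tau> i = n + 1 - \<tau> (j + 1 - k)"
          using ci_mirror[OF \<tau>, of "j + 1 - k"] by simp
        also have "\<tau> (j + 1 - k) = j + 1 - \<beta> k"
          using block[OF k'] ci_mirror[OF \<beta> k(2)] by simp
        finally show ?thesis
          using k ci_closed[OF \<beta> k(2)] by (simp add: sandwich_right n_eq)
      next
        case 5
        then have "i \<notin> {1..n}" "i - j - m \<notin> {1..j}" "\<not> i \<le> j" "\<not> i - j \<le> m"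
          by (auto simp: n_eq)
        then show ?thesis
          using 5 ci_fixes_outside[OF \<tau>] ci_fixes_outside[OF \<beta>]
          by (simp add: n_eq sandwich_def direct_sum_def)
      qed
    qed
    ultimately have "\<exists>\<tau>'\<in>centrosymmetric_involutions (n - 2 * j). \<tau> = sandwich \<beta> j (n - 2 * j) \<tau>'"
      unfolding m_def by blast
    moreover have "j \<in> {1..n div 2}"
      using double j by auto
    ultimately show ?thesis
      unfolding j_def by blast
  qed
qed

text \<open>A permutation in the class that is not a single block is determined by the size \<open>j\<close> of its
  first block and by what remains after this block and its mirror image are removed. The remainder
  can be any member of the class of length \<open>n - 2 * j\<close>, since no pattern in \<open>P\<close> can reach across the
  border of a summand.\<close>

lemma card_CI_blocks:
  fixes b :: "nat \<Rightarrow> nat \<Rightarrow> nat"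
  assumes n: "1 \<le> n" and b: "\<And>j. 1 \<le> j \<Longrightarrow> b j \<in> centrosymmetric_involutions j"
    and b1: "\<And>j. 1 \<le> j \<Longrightarrow> b j 1 = j"
    and indecomposable: "\<And>\<pi>. \<pi> \<in> P \<Longrightarrow> sum_indecomposable \<pi>"
    and first: "\<And>\<tau> i. \<tau> \<in> CI n P \<Longrightarrow> i \<in> {1..\<tau> 1} \<Longrightarrow> \<tau> i = b (\<tau> 1) i"
  shows "card (CI n P) = (if b n \<in> CI n P then 1 else 0) +
    (\<Sum>j | j \<in> {1..n div 2} \<and> b j \<in> CI j P. card (CI (n - 2 * j) P))"
proof -
  define J where "J = {j. j \<in> {1..n div 2} \<and> b j \<in> CI j P}"
  define S where "S j = sandwich (b j) j (n - 2 * j)" for j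
  have ci: "\<tau> \<in> centrosymmetric_involutions k" if "\<tau> \<in> CI k P" for \<tau> k
    using that by (simp add: CI_def)
  have S_CI: "S j \<tau> \<in> CI n P \<longleftrightarrow> b j \<in> CI j P \<and> \<tau> \<in> CI (n - 2 * j) P"
    if "j \<in> {1..n div 2}" "\<tau> \<in> centrosymmetric_involutions (n - 2 * j)" for j \<tau>
  proof -
    have "2 * j + (n - 2 * j) = n"
      using that(1) by auto
    moreover have bj: "b j \<in> centrosymmetric_involutions j"
      using b that(1) by auto
    ultimately show ?thesis
      using sandwich_ci[OF bj that(2)] contains_sandwich_indecomposable[OF indecomposable bj that(2)] bj that(2)
      by (auto simp: CI_def S_def)
  qed
  have S_1: "S j \<tau> 1 = j" if "j \<in> J" for j \<tau>
    using that b1 by (simp add: J_def S_def sandwich_left)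
  have union: "CI n P = ({b n} \<inter> CI n P) \<union> (\<Union>j\<in>J. S j ` CI (n - 2 * j) P)" (is "_ = ?A \<union> ?B")
  proof (intro equalityI subsetI)
    fix \<tau> assume \<tau>: "\<tau> \<in> CI n P"
    have "1 \<le> \<tau> 1"
      using ci_bounds[OF ci[OF \<tau>], of 1] n by simp
    have "(\<tau> 1 = n \<and> \<tau> = b (\<tau> 1)) \<or> (\<tau> 1 \<in> {1..n div 2} \<and>
        (\<exists>\<tau>' \<in> centrosymmetric_involutions (n - 2 * \<tau> 1).
          \<tau> = sandwich (b (\<tau> 1)) (\<tau> 1) (n - 2 * \<tau> 1) \<tau>'))"
      using ci_first_block[OF ci[OF \<tau>] n b[OF \<open>1 \<le> \<tau> 1\<close>]] first[OF \<tau>] by blast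
    then show "\<tau> \<in> ?A \<union> ?B"
    proof (elim disjE conjE bexE)
      fix \<tau>' assume \<tau>': "\<tau>' \<in> centrosymmetric_involutions (n - 2 * \<tau> 1)" "\<tau> 1 \<in> {1..n div 2}"
        "\<tau> = sandwich (b (\<tau> 1)) (\<tau> 1) (n - 2 * \<tau> 1) \<tau>'"
      then have "S (\<tau> 1) \<tau>' \<in> CI n P"
        using \<tau> by (simp add: S_def)
      then have "b (\<tau> 1) \<in> CI (\<tau> 1) P" "\<tau>' \<in> CI (n - 2 * \<tau> 1) P"
        using S_CI[OF \<tau>'(2,1)] by blast+
      then show ?thesis
        using \<tau>' by (auto simp: J_def S_def)
    qed (use \<tau> in auto)
  next
    fix \<tau> assume "\<tau> \<in> ?A \<union> ?B"
    then show "\<tau> \<in> CI n P"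
      using S_CI ci by (auto simp: J_def)
  qed
  have disjoint: "?A \<inter> ?B = {}"
  proof -
    have "b n \<noteq> S j \<tau>" if "j \<in> J" for j \<tau>
    proof
      assume "b n = S j \<tau>"
      then have "n = j"
        using S_1[OF that, of \<tau>] b1[OF n] by simp
      with that n show False
        by (auto simp: J_def)
    qed
    then show ?thesis by blast
  qed
  have "finite J"
    by (simp add: J_def)
  have "card (CI n P) = card (?A \<union> ?B)"
    using union by simp
  also have "\<dots> = card ?A + card ?B"
    using \<open>finite J\<close> by (intro card_Un_disjoint disjoint) auto
  also have "card ?B = (\<Sum>j\<in>J. card (S j ` CI (n - 2 * j) P))"
  proof (intro card_UN_disjoint \<open>finite J\<close> ballI impI finite_imageI finite_CI)
    fix j k assume jk: "j \<in> J" "k \<in> J" "j \<noteq> k"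
    have "S j \<tau> \<noteq> S k \<tau>'" for \<tau> \<tau>'
      using S_1[OF jk(1), of \<tau>] S_1[OF jk(2), of \<tau>'] jk(3) by metis
    then show "S j ` CI (n - 2 * j) P \<inter> S k ` CI (n - 2 * k) P = {}"
      by blast
  qed
  also have "\<dots> = (\<Sum>j\<in>J. card (CI (n - 2 * j) P))"
  proof (intro sum.cong refl card_image inj_onI)
    fix j \<tau> \<tau>' assume "\<tau> \<in> CI (n - 2 * j) P" "\<tau>' \<in> CI (n - 2 * j) P" "S j \<tau> = S j \<tau>'"
    then show "\<tau> = \<tau>'"
      unfolding S_def using ci sandwich_inject by blast
  qed
  also have "card ?A = (if b n \<in> CI n P then 1 else 0)"
    by simp
  finally show ?thesis
    by (simp add: J_def)
qed

section \<open>The first block is forced\<close>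

text \<open>If \<open>1 < i < \<tau> 1 < \<tau> i\<close>, then the values at these four positions are
  \<open>\<tau> 1, \<tau> i, 1, i\<close>, an occurrence of 3412, and leaving out the second gives one of 312.\<close>

lemma ci_first_block_invariant:
  assumes \<tau>: "\<tau> \<in> centrosymmetric_involutions n" and "1 \<le> n" and i: "i \<in> {1..\<tau> 1}"
    and avoid: "\<not> contains_pattern n \<tau> [3, 1, 2] \<or> \<not> contains_pattern n \<tau> [3, 4, 1, 2]"
  shows "\<tau> i \<in> {1..\<tau> 1}"
proof (rule ccontr)
  assume out: "\<tau> i \<notin> {1..\<tau> 1}"
  have n: "\<tau> 1 \<le> n"
    using ci_bounds[OF \<tau>, of 1] \<open>1 \<le> n\<close> by simp
  have "1 \<le> \<tau> i \<and> \<tau> i \<le> n"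
    using ci_bounds[OF \<tau>, of i] i n by simp
  moreover have "i \<noteq> 1" "i \<noteq> \<tau> 1"
    using out i ci_invol[OF \<tau>, of 1] by auto
  ultimately have "1 < i" "i < \<tau> 1" "\<tau> 1 < \<tau> i" "\<tau> i \<le> n"
    using out i by auto
  moreover from this have "\<tau> (\<tau> 1) < \<tau> (\<tau> i)" "\<tau> (\<tau> i) < \<tau> 1"
    by (simp_all add: ci_invol[OF \<tau>])
  ultimately have "contains_pattern n \<tau> [3, 1, 2]" "contains_pattern n \<tau> [3, 4, 1, 2]"
    unfolding contains_312 contains_3412 using le_refl[of 1] by (blast intro: order.strict_trans)+
  with avoid show False by blast
qed

text \<open>An ascent in the block would form 312 together with the value \<open>\<tau> 1\<close> in front.\<close>

lemma ci_first_block_flip: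
  assumes \<tau>: "\<tau> \<in> centrosymmetric_involutions n" and "1 \<le> n" and i: "i \<in> {1..\<tau> 1}"
    and avoid: "\<not> contains_pattern n \<tau> [3, 1, 2]"
  shows "\<tau> i = flip (\<tau> 1) i"
proof (rule strict_antimono_self_map_unique[where A = "{1..\<tau> 1}" and g = \<tau> and g' = "flip (\<tau> 1)" and x = i])
  have n: "\<tau> 1 \<le> n"
    using ci_bounds[OF \<tau>, of 1] \<open>1 \<le> n\<close> by simp
  show closed: "\<tau> ` {1..\<tau> 1} \<subseteq> {1..\<tau> 1}"
    using ci_first_block_invariant[OF \<tau> \<open>1 \<le> n\<close>] avoid by blast
  fix x y assume xy: "x \<in> {1..\<tau> 1}" "y \<in> {1..\<tau> 1}" "x < y"
  have le: "\<tau> y \<le> \<tau> 1"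
    using ci_first_block_invariant[OF \<tau> \<open>1 \<le> n\<close> xy(2)] avoid by auto
  have neq: "\<tau> y \<noteq> \<tau> 1" "\<tau> x \<noteq> \<tau> y"
    using xy by (auto simp: ci_eq_iff[OF \<tau>])
  show "\<tau> y < \<tau> x"
  proof (rule ccontr)
    assume not: "\<not> \<tau> y < \<tau> x"
    then have "x \<noteq> 1"
      using le neq(1) by auto
    then have "1 < x" "y \<le> n" "\<tau> x < \<tau> y" "\<tau> y < \<tau> 1"
      using xy not le neq n by auto
    then have "contains_pattern n \<tau> [3, 1, 2]"
      unfolding contains_312 using xy(3) le_refl[of 1] by blast
    with avoid show False by blast
  qed
qed (use i in \<open>auto simp: flip_def\<close>)

text \<open>A descent in the interior of the block would form 4321 together with the value \<open>\<tau> 1\<close> in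
  front and the value 1 at the end. So the interior is increasing and hence fixed pointwise.\<close>

lemma ci_first_block_transpose:
  assumes \<tau>: "\<tau> \<in> centrosymmetric_involutions n" and "1 \<le> n" and i: "i \<in> {1..\<tau> 1}"
    and avoid: "\<not> contains_pattern n \<tau> [3, 4, 1, 2]" "\<not> contains_pattern n \<tau> [4, 3, 2, 1]"
  shows "\<tau> i = transpose 1 (\<tau> 1) i"
proof -
  have n: "\<tau> 1 \<le> n"
    using ci_bounds[OF \<tau>, of 1] \<open>1 \<le> n\<close> by simp
  have last: "\<tau> (\<tau> 1) = 1"
    by (rule ci_invol[OF \<tau>])
  have closed: "\<tau> x \<in> {2..\<tau> 1 - 1}" if "x \<in> {2..\<tau> 1 - 1}" for x
  proof -
    have "\<tau> x \<in> {1..\<tau> 1}"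
      using ci_first_block_invariant[OF \<tau> \<open>1 \<le> n\<close>, of x] avoid(1) that by auto
    moreover have "\<tau> x \<noteq> \<tau> 1" "\<tau> x \<noteq> \<tau> (\<tau> 1)"
      using that by (auto simp only: ci_eq_iff[OF \<tau>] atLeastAtMost_iff)
    ultimately show ?thesis
      using last by auto
  qed
  have "\<tau> x = x" if "x \<in> {2..\<tau> 1 - 1}" for x
  proof (rule strict_mono_self_map_id[OF _ _ _ that])
    fix x y assume xy: "x \<in> {2..\<tau> 1 - 1}" "y \<in> {2..\<tau> 1 - 1}" "x < y"
    show "\<tau> x < \<tau> y"
    proof (rule ccontr)
      assume "\<not> \<tau> x < \<tau> y"
      moreover have "\<tau> x \<noteq> \<tau> y"
        using xy(3) by (simp add: ci_eq_iff[OF \<tau>])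
      ultimately have "1 < x" "y < \<tau> 1" "\<tau> (\<tau> 1) < \<tau> y" "\<tau> y < \<tau> x" "\<tau> x < \<tau> 1"
        using xy last closed[OF xy(1)] closed[OF xy(2)] by auto
      then have "contains_pattern n \<tau> [4, 3, 2, 1]"
        unfolding contains_4321 using n xy(3) le_refl[of 1] by blast
      with avoid(2) show False by blast
    qed
  qed (use closed in auto)
  moreover have "i = 1 \<or> i = \<tau> 1 \<or> i \<in> {2..\<tau> 1 - 1}"
    using i by auto
  ultimately show ?thesis
    using last by (metis transpose_apply_first transpose_apply_second transpose_apply_other)
qed

lemma transpose_ci: "1 \<le> j \<Longrightarrow> transpose 1 j \<in> centrosymmetric_involutions j"
  by (auto simp: centrosymmetric_involutions_iff transpose_def)

text \<open>Every inversion of the block involves one of its two end points. In 3412 and 4321, however,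
  the two middle letters are inverted as well.\<close>

lemma transpose_avoids:
  assumes "1 \<le> j"
  shows "\<not> contains_pattern j (transpose 1 j) [3, 4, 1, 2]"
    and "\<not> contains_pattern j (transpose 1 j) [4, 3, 2, 1]"
    and "contains_pattern j (transpose 1 j) [3, 2, 1] \<longleftrightarrow> 3 \<le> j"
proof -
  have inv: "a = 1 \<or> b = j" if "1 \<le> a" "a < b" "b \<le> j" "transpose 1 j b < transpose 1 j a" for a b
    using that by (auto simp: transpose_def split: if_splits)
  show "\<not> contains_pattern j (transpose 1 j) [3, 4, 1, 2]"
  proof
    assume "contains_pattern j (transpose 1 j) [3, 4, 1, 2]"
    then obtain p q r s where "1 \<le> p" "p < q" "q < r" "r < s" "s \<le> j"
      "transpose 1 j r < transpose 1 j s" "transpose 1 j s < transpose 1 j p"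
      "transpose 1 j p < transpose 1 j q"
      unfolding contains_3412 by blast
    then show False
      using inv[of q r] by simp
  qed
  show "\<not> contains_pattern j (transpose 1 j) [4, 3, 2, 1]"
  proof
    assume "contains_pattern j (transpose 1 j) [4, 3, 2, 1]"
    then obtain p q r s where "1 \<le> p" "p < q" "q < r" "r < s" "s \<le> j" "transpose 1 j r < transpose 1 j q"
      unfolding contains_4321 by blast
    then show False
      using inv[of q r] by simp
  qed
  show "contains_pattern j (transpose 1 j) [3, 2, 1] \<longleftrightarrow> 3 \<le> j"
  proof
    assume "3 \<le> j"
    then have "(1::nat) < 2" "2 < j" "transpose 1 j j < transpose 1 j 2" "transpose 1 j 2 < transpose 1 j 1"
      by (auto simp: transpose_def)
    then show "contains_pattern j (transpose 1 j) [3, 2, 1]"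
      unfolding contains_321 by blast
  next
    assume "contains_pattern j (transpose 1 j) [3, 2, 1]"
    then show "3 \<le> j"
      unfolding contains_321 by auto
  qed
qed


section \<open>Counting by palindromic block decompositions\<close>

lemma sum_indecomposable_patterns:
  "sum_indecomposable [3, 1, 2]" "sum_indecomposable [3, 2, 1]"
  "sum_indecomposable [3, 4, 1, 2]" "sum_indecomposable [4, 3, 2, 1]"
proof -
  have "m = 1 \<or> m = 2" if "0 < m" "m < 3" for m :: nat
    using that by linarith
  then show "sum_indecomposable [3, 1, 2]" "sum_indecomposable [3, 2, 1]"
    unfolding sum_indecomposable_def splits_at_def
    by (fastforce simp: eval_nat_numeral All_less_Suc nth_Cons')+
  have "m = 1 \<or> m = 2 \<or> m = 3" if "0 < m" "m < 4" for m :: nat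
    using that by linarith
  then show "sum_indecomposable [3, 4, 1, 2]" "sum_indecomposable [4, 3, 2, 1]"
    unfolding sum_indecomposable_def splits_at_def
    by (fastforce simp: eval_nat_numeral All_less_Suc nth_Cons')+
qed

lemma flip_CI_iff: "flip n \<in> CI n P \<longleftrightarrow> (\<forall>\<pi>\<in>P. n < length \<pi> \<or> \<not> sorted_wrt (>) \<pi>)"
  by (auto simp: CI_def flip_ci contains_pattern_flip)

lemma contains_321_if_4321:
  assumes "contains_pattern n \<sigma> [4, 3, 2, 1]"
  shows "contains_pattern n \<sigma> [3, 2, 1]"
proof -
  obtain i j k l where "1 \<le> i" "i < j" "j < k" "k < l" "l \<le> n" "\<sigma> l < \<sigma> k" "\<sigma> k < \<sigma> j" "\<sigma> j < \<sigma> i"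
    using assms unfolding contains_4321 by blast
  then have "1 \<le> i" "i < j" "j < k" "k \<le> n" "\<sigma> k < \<sigma> j" "\<sigma> j < \<sigma> i"
    by auto
  then show ?thesis
    unfolding contains_321 by blast
qed

lemma contains_312_if_3412:
  assumes "contains_pattern n \<sigma> [3, 4, 1, 2]"
  shows "contains_pattern n \<sigma> [3, 1, 2]"
proof -
  obtain i j k l where "1 \<le> i" "i < j" "j < k" "k < l" "l \<le> n" "\<sigma> k < \<sigma> l" "\<sigma> l < \<sigma> i" "\<sigma> i < \<sigma> j"
    using assms unfolding contains_3412 by blast
  then have "1 \<le> i" "i < k" "k < l" "l \<le> n" "\<sigma> k < \<sigma> l" "\<sigma> l < \<sigma> i"
    by auto
  then show ?thesis
    unfolding contains_312 by blast
qed

lemma card_CI_flip_blocks: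
  assumes "1 \<le> n" "[3, 1, 2] \<in> P" "\<And>\<pi>. \<pi> \<in> P \<Longrightarrow> sum_indecomposable \<pi>"
  shows "card (CI n P) = (if flip n \<in> CI n P then 1 else 0) +
    (\<Sum>j | j \<in> {1..n div 2} \<and> flip j \<in> CI j P. card (CI (n - 2 * j) P))"
proof (rule card_CI_blocks[OF assms(1)])
  fix \<tau> i assume "\<tau> \<in> CI n P" "i \<in> {1..\<tau> 1}"
  then show "\<tau> i = flip (\<tau> 1) i"
    using ci_first_block_flip[of \<tau> n i] assms(1,2) by (auto simp: CI_def)
qed (auto simp: flip_ci assms(3), simp add: flip_def)

lemma card_CI_transpose_blocks:
  assumes "1 \<le> n" "[3, 4, 1, 2] \<in> P" "[3, 2, 1] \<in> P \<or> [4, 3, 2, 1] \<in> P"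
    "\<And>\<pi>. \<pi> \<in> P \<Longrightarrow> sum_indecomposable \<pi>"
  shows "card (CI n P) = (if transpose 1 n \<in> CI n P then 1 else 0) +
    (\<Sum>j | j \<in> {1..n div 2} \<and> transpose 1 j \<in> CI j P. card (CI (n - 2 * j) P))"
proof (rule card_CI_blocks[OF assms(1)])
  fix \<tau> i assume \<tau>: "\<tau> \<in> CI n P" and i: "i \<in> {1..\<tau> 1}"
  then have "\<not> contains_pattern n \<tau> [3, 4, 1, 2]" "\<not> contains_pattern n \<tau> [4, 3, 2, 1]"
    using assms(2,3) contains_321_if_4321 unfolding CI_def by blast+
  then show "\<tau> i = transpose 1 (\<tau> 1) i"
    using ci_first_block_transpose[of \<tau> n i] assms(1) \<tau> i by (simp add: CI_def)
qed (use assms(4) transpose_ci in auto)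

lemma sum_powers_2: "(\<Sum>j = 1..h. 2 ^ (h - j)) + 1 = (2::nat) ^ h"
proof (induction h)
  case (Suc h)
  have "(\<Sum>j = 1..h. 2 ^ (Suc h - j)) = (\<Sum>j = 1..h. 2 * 2 ^ (h - j) :: nat)"
    by (intro sum.cong) (auto simp: Suc_diff_le)
  with Suc show ?case
    by (simp add: sum_distrib_left[symmetric])
qed simp

text \<open>The recurrence of the palindromic compositions: a single part, or two equal parts \<open>j\<close>
  around a palindromic composition of \<open>n - 2 * j\<close>.\<close>

lemma palindromic_composition_count:
  fixes f :: "nat \<Rightarrow> nat"
  assumes f0: "f 0 = 1" and rec: "\<And>n. 1 \<le> n \<Longrightarrow> f n = 1 + (\<Sum>j = 1..n div 2. f (n - 2 * j))"
  shows "f n = 2 ^ (n div 2)"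
proof (induction n rule: less_induct)
  case (less n)
  show ?case
  proof (cases "n = 0")
    case False
    have "f (n - 2 * j) = 2 ^ (n div 2 - j)" if "j \<in> {1..n div 2}" for j
    proof -
      have "n - 2 * j < n" "(n - 2 * j) div 2 = n div 2 - j"
        using that by auto
      then show ?thesis using less by simp
    qed
    then have "f n = 1 + (\<Sum>j = 1..n div 2. 2 ^ (n div 2 - j))"
      using rec[of n] False by simp
    then show ?thesis
      using sum_powers_2[of "n div 2"] by simp
  qed (simp add: f0)
qed

theorem card_CI_312: "card (CI n {[3, 1, 2]}) = 2 ^ (n div 2)"
proof (rule palindromic_composition_count)
  let ?P = "{[3, 1, 2]} :: nat list set"
  fix n :: nat assume "1 \<le> n"
  have block: "flip j \<in> CI j ?P" for j
    by (simp add: flip_CI_iff)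
  have "card (CI n ?P) = (if flip n \<in> CI n ?P then 1 else 0) +
    (\<Sum>j | j \<in> {1..n div 2} \<and> flip j \<in> CI j ?P. card (CI (n - 2 * j) ?P))"
    using \<open>1 \<le> n\<close> sum_indecomposable_patterns(1) by (intro card_CI_flip_blocks) blast+
  moreover have "{j. j \<in> {1..n div 2} \<and> flip j \<in> CI j ?P} = {1..n div 2}"
    using block by blast
  ultimately show "card (CI n ?P) = 1 + (\<Sum>j = 1..n div 2. card (CI (n - 2 * j) ?P))"
    using block by simp
qed (simp add: CI_0)

theorem CI_3412_312: "CI n {[3, 4, 1, 2], [3, 1, 2]} = CI n {[3, 1, 2]}"
  unfolding CI_def using contains_312_if_3412 by blast

theorem card_CI_3412_4321: "card (CI n {[3, 4, 1, 2], [4, 3, 2, 1]}) = 2 ^ (n div 2)"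
proof (rule palindromic_composition_count)
  let ?P = "{[3, 4, 1, 2], [4, 3, 2, 1]} :: nat list set"
  fix n :: nat assume "1 \<le> n"
  have block: "transpose 1 j \<in> CI j ?P" if "1 \<le> j" for j
    using that transpose_avoids(1,2) transpose_ci unfolding CI_def by blast
  have "card (CI n ?P) = (if transpose 1 n \<in> CI n ?P then 1 else 0) +
    (\<Sum>j | j \<in> {1..n div 2} \<and> transpose 1 j \<in> CI j ?P. card (CI (n - 2 * j) ?P))"
    using \<open>1 \<le> n\<close> sum_indecomposable_patterns(3,4) by (intro card_CI_transpose_blocks) blast+
  moreover have "{j. j \<in> {1..n div 2} \<and> transpose 1 j \<in> CI j ?P} = {1..n div 2}"
    using block by auto
  ultimately show "card (CI n ?P) = 1 + (\<Sum>j = 1..n div 2. card (CI (n - 2 * j) ?P))"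
    using block[OF \<open>1 \<le> n\<close>] by simp
qed (simp add: CI_0)

text \<open>A decreasing block avoids 4321 as long as its size is at most three.\<close>

theorem card_CI_4321_312:
  "card (CI n {[4, 3, 2, 1], [3, 1, 2]}) = tribonacci (n div 2 + 1) + tribonacci (n div 2 + 2)"
proof (induction n rule: less_induct)
  case (less n)
  let ?P = "{[4, 3, 2, 1], [3, 1, 2]} :: nat list set"
  show ?case
  proof (cases "n = 0")
    case False
    then have "1 \<le> n"
      by simp
    have block: "flip j \<in> CI j ?P \<longleftrightarrow> j < 4" for j
      by (simp add: flip_CI_iff numeral_eq_Suc)
    have "card (CI n ?P) = (if flip n \<in> CI n ?P then 1 else 0) +
        (\<Sum>j | j \<in> {1..n div 2} \<and> flip j \<in> CI j ?P. card (CI (n - 2 * j) ?P))"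
      using \<open>1 \<le> n\<close> sum_indecomposable_patterns(1,4) by (intro card_CI_flip_blocks) blast+
    moreover have "card (CI (n - 2 * j) ?P) = tribonacci (n div 2 - j + 1) + tribonacci (n div 2 - j + 2)"
      if "j \<in> {1..n div 2}" for j
    proof -
      have "n - 2 * j < n" "(n - 2 * j) div 2 = n div 2 - j"
        using that by auto
      then show ?thesis using less by simp
    qed
    ultimately have count: "card (CI n ?P) = (if n < 4 then 1 else 0) +
        (\<Sum>j | j \<in> {1..n div 2} \<and> j < 4. tribonacci (n div 2 - j + 1) + tribonacci (n div 2 - j + 2))"
      unfolding block by simp
    consider "n div 2 = 0" | "n div 2 = 1" | "n div 2 = 2" | "3 \<le> n div 2"
      by linarith
    then show ?thesis
    proof cases
      case 1
      then have blocks: "{j. j \<in> {1..n div 2} \<and> j < 4} = {}" and n: "n < 4"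
        by auto
      show ?thesis
        unfolding count blocks using 1 n by (simp add: eval_nat_numeral)
    next
      case 2
      then have blocks: "{j. j \<in> {1..n div 2} \<and> j < 4} = {1}" and n: "n < 4"
        by auto
      show ?thesis
        unfolding count blocks using 2 n by (simp add: eval_nat_numeral)
    next
      case 3
      then have blocks: "{j. j \<in> {1..n div 2} \<and> j < 4} = {1, 2}" and n: "\<not> n < 4"
        by auto
      show ?thesis
        unfolding count blocks using 3 n by (simp add: eval_nat_numeral)
    next
      case 4
      then have blocks: "{j. j \<in> {1..n div 2} \<and> j < 4} = {1, 2, 3}" and n: "\<not> n < 4"
        by auto
      obtain h where "n div 2 = h + 3"
        using 4 by (metis le_add_diff_inverse2)
      with n show ?thesis
        unfolding count blocks by (simp add: eval_nat_numeral)
    qed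
  qed (simp add: CI_0 eval_nat_numeral)
qed

text \<open>A transposition block avoids 321 only if it has no interior, so the blocks have size one or
  two.\<close>

lemma card_CI_3412_321_rec:
  assumes "1 \<le> n"
  shows "card (CI n {[3, 4, 1, 2], [3, 2, 1]}) = (if n < 3 then 1 else 0) +
    (if 2 \<le> n then card (CI (n - 2) {[3, 4, 1, 2], [3, 2, 1]}) else 0) +
    (if 4 \<le> n then card (CI (n - 4) {[3, 4, 1, 2], [3, 2, 1]}) else 0)"
proof -
  let ?P = "{[3, 4, 1, 2], [3, 2, 1]} :: nat list set"
  have block: "transpose 1 j \<in> CI j ?P \<longleftrightarrow> j < 3" if "1 \<le> j" for j
    using transpose_avoids(1,3)[OF that] transpose_ci[OF that] unfolding CI_def by auto
  have "card (CI n ?P) = (if transpose 1 n \<in> CI n ?P then 1 else 0) +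
      (\<Sum>j | j \<in> {1..n div 2} \<and> transpose 1 j \<in> CI j ?P. card (CI (n - 2 * j) ?P))"
    using assms sum_indecomposable_patterns(2,3) by (intro card_CI_transpose_blocks) blast+
  also have "{j. j \<in> {1..n div 2} \<and> transpose 1 j \<in> CI j ?P} = {j. j \<in> {1..n div 2} \<and> j < 3}"
    using block by (intro Collect_cong conj_cong refl) (simp only: atLeastAtMost_iff)
  also have "\<dots> = (if 2 \<le> n then {1} else {}) \<union> (if 4 \<le> n then {2} else {})"
    by auto
  finally show ?thesis
    using block[OF assms] by simp
qed

theorem card_CI_even_3412_321: "card (CI (2 * h) {[3, 4, 1, 2], [3, 2, 1]}) = fib (h + 2)"
proof (induction h rule: fib.induct)
  case (3 h)
  then show ?case
    using card_CI_3412_321_rec[of "2 * Suc (Suc h)"] by simp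
qed (use card_CI_3412_321_rec[of 2] in \<open>simp_all add: CI_0 numeral_eq_Suc\<close>)

theorem card_CI_odd_3412_321: "card (CI (2 * h + 1) {[3, 4, 1, 2], [3, 2, 1]}) = fib (h + 1)"
proof (induction h rule: fib.induct)
  case (3 h)
  then show ?case
    using card_CI_3412_321_rec[of "2 * Suc (Suc h) + 1"] by simp
qed (use card_CI_3412_321_rec[of 1] card_CI_3412_321_rec[of 3] in \<open>simp_all add: numeral_eq_Suc\<close>)

section \<open>Layered involutions avoiding 1234 or 2143\<close>

text \<open>Each of the three decreasing blocks accommodates at most one letter.\<close>

lemma sandwich_flip_avoids_1234:
  "\<not> contains_pattern (2 * j + m) (sandwich (flip j) j m (flip m)) [1, 2, 3, 4]"
proof
  let ?\<pi> = "[1, 2, 3, 4] :: nat list"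
  assume "contains_pattern (2 * j + m) (sandwich (flip j) j m (flip m)) ?\<pi>"
  then obtain p q where p: "p \<le> length ?\<pi>" and "contains_pattern j (flip j) (take p ?\<pi>)"
    and q: "q \<le> length ?\<pi> - p" and
    "contains_pattern m (flip m) (take q (drop p ?\<pi>))" "contains_pattern j (flip j) (drop (p + q) ?\<pi>)"
    unfolding contains_sandwich[OF flip_ci flip_ci] by blast
  moreover have "sorted_wrt (<) ?\<pi>"
    by simp
  ultimately have "length (take p ?\<pi>) \<le> 1" "length (take q (drop p ?\<pi>)) \<le> 1"
    "length (drop (p + q) ?\<pi>) \<le> 1"
    by (blast intro: increasing_in_flip sorted_wrt_take sorted_wrt_drop)+
  with p q show False
    by auto
qed

lemma CI_312_cases:
  assumes \<tau>: "\<tau> \<in> centrosymmetric_involutions n" "\<not> contains_pattern n \<tau> [3, 1, 2]" and n: "1 \<le> n"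
  obtains "\<tau> = flip n"
  | j \<tau>' where "j \<in> {1..n div 2}" "\<tau>' \<in> centrosymmetric_involutions (n - 2 * j)"
    "\<tau> = sandwich (flip j) j (n - 2 * j) \<tau>'"
proof -
  have "\<tau> 1 = n \<and> \<tau> = flip (\<tau> 1) \<or> (\<tau> 1 \<in> {1..n div 2} \<and>
    (\<exists>\<tau>' \<in> centrosymmetric_involutions (n - 2 * \<tau> 1).
      \<tau> = sandwich (flip (\<tau> 1)) (\<tau> 1) (n - 2 * \<tau> 1) \<tau>'))"
    using ci_first_block[OF \<tau>(1) n flip_ci] ci_first_block_flip[OF \<tau>(1) n _ \<tau>(2)] by blast
  with that show thesis
    by metis
qed

lemma flip_neq_sandwich:
  assumes "j \<in> {1..n div 2}"
  shows "flip n \<noteq> sandwich (flip j) j m \<tau>"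
proof
  assume "flip n = sandwich (flip j) j m \<tau>"
  then have "flip n 1 = flip j 1"
    using assms by (simp add: sandwich_left)
  moreover have "1 \<le> j" "j < n"
    using assms by auto
  ultimately show False
    by (simp add: flip_def)
qed

text \<open>An ascent in the middle part would be completed to 1234 by the first and the last position,
  so the middle part is a decreasing block as well.\<close>

lemma CI_1234_312:
  assumes n: "1 \<le> n"
  shows "CI n {[1, 2, 3, 4], [3, 1, 2]} =
    insert (flip n) ((\<lambda>j. sandwich (flip j) j (n - 2 * j) (flip (n - 2 * j))) ` {1..n div 2})"
    (is "CI n ?P = insert _ (?S ` ?J)")
proof (intro equalityI subsetI)
  fix \<tau> assume "\<tau> \<in> CI n ?P"
  then have \<tau>: "\<tau> \<in> centrosymmetric_involutions n" "\<not> contains_pattern n \<tau> [3, 1, 2]"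
    "\<not> contains_pattern n \<tau> [1, 2, 3, 4]"
    unfolding CI_def by blast+
  from \<tau>(1,2) n show "\<tau> \<in> insert (flip n) (?S ` ?J)"
  proof (cases rule: CI_312_cases)
    case (2 j \<tau>')
    define m where "m = n - 2 * j"
    note \<tau>' = 2(2)[folded m_def] and sandwich = 2(3)[folded m_def]
    have n_eq: "n = 2 * j + m"
      using 2(1) by (auto simp: m_def)
    have decreasing: "\<tau>' y < \<tau>' x" if xy: "x \<in> {1..m}" "y \<in> {1..m}" "x < y" for x y
    proof (rule ccontr)
      assume "\<not> \<tau>' y < \<tau>' x"
      moreover have "\<tau>' x \<noteq> \<tau>' y"
        using xy(3) by (simp add: ci_eq_iff[OF \<tau>'])
      ultimately have "\<tau>' x < \<tau>' y"
        by simp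
      moreover have "j + m + j = n"
        by (simp add: n_eq)
      then have "\<tau> 1 = j" "\<tau> n = j + m + 1" "\<tau> (j + x) = j + \<tau>' x" "\<tau> (j + y) = j + \<tau>' y"
        using 2(1) xy sandwich_right[of j "flip j" j m \<tau>']
        by (auto simp: sandwich sandwich_left sandwich_middle flip_def)
      ultimately have "1 < j + x" "j + x < j + y" "j + y < n" "\<tau> 1 < \<tau> (j + x)"
          "\<tau> (j + x) < \<tau> (j + y)" "\<tau> (j + y) < \<tau> n"
        using xy 2(1) ci_closed[OF \<tau>' xy(1)] ci_closed[OF \<tau>' xy(2)] by (auto simp: n_eq)
      then have "contains_pattern n \<tau> [1, 2, 3, 4]"
        unfolding contains_1234 using le_refl[of 1] le_refl[of n] by blast
      with \<tau>(3) show False ..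
    qed
    have "\<tau>' i = flip m i" for i
    proof (cases "i \<in> {1..m}")
      case True
      have "\<tau>' ` {1..m} \<subseteq> {1..m}" "flip m ` {1..m} \<subseteq> {1..m}"
        using ci_closed[OF \<tau>'] ci_closed[OF flip_ci] by blast+
      moreover have "flip m y < flip m x" if "x \<in> {1..m}" "y \<in> {1..m}" "x < y" for x y
        using that by (auto simp: flip_def)
      ultimately show ?thesis
        using strict_antimono_self_map_unique[of "{1..m}" \<tau>' "flip m" i] decreasing True by blast
    qed (auto simp: ci_fixes_outside[OF \<tau>'] flip_def)
    then have "\<tau>' = flip m" ..
    with 2(1) sandwich show ?thesis
      by (auto simp: m_def)
  qed blast
next
  fix \<tau> assume "\<tau> \<in> insert (flip n) (?S ` ?J)"
  then show "\<tau> \<in> CI n ?P"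
  proof (elim insertE imageE)
    fix j assume j: "j \<in> ?J" "\<tau> = ?S j"
    then have "2 * j + (n - 2 * j) = n"
      by auto
    then have "?S j \<in> centrosymmetric_involutions n" "\<not> contains_pattern n (?S j) [1, 2, 3, 4]"
      "\<not> contains_pattern n (?S j) [3, 1, 2]"
      using sandwich_ci[OF flip_ci flip_ci, of j "n - 2 * j"] sandwich_flip_avoids_1234[of j "n - 2 * j"]
        contains_sandwich_indecomposable[OF sum_indecomposable_patterns(1) flip_ci flip_ci, of j "n - 2 * j"]
      by (simp_all add: contains_pattern_flip)
    with j(2) show ?thesis
      unfolding CI_def by blast
  qed (simp add: flip_CI_iff)
qed

lemma card_CI_1234_312: "card (CI n {[1, 2, 3, 4], [3, 1, 2]}) = n div 2 + 1"
proof (cases "n = 0")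
  case False
  define S where "S j = sandwich (flip j) j (n - 2 * j) (flip (n - 2 * j))" for j
  have "S j 1 = j" if "j \<in> {1..n div 2}" for j
    using that by (simp add: S_def sandwich_left flip_def)
  then have "inj_on S {1..n div 2}"
    by (metis inj_onI)
  moreover have "flip n \<notin> S ` {1..n div 2}"
    using flip_neq_sandwich unfolding S_def by blast
  ultimately show ?thesis
    using CI_1234_312[of n] False by (simp add: S_def[symmetric] card_image)
qed (simp add: CI_0)

text \<open>The outer points can play no part in an occurrence, because 2143 neither begins with
  its least nor ends with its greatest letter.\<close>

lemma sandwich_point_contains_2143:
  assumes \<tau>: "\<tau> \<in> centrosymmetric_involutions m"
  shows "contains_pattern (2 * 1 + m) (sandwich (flip 1) 1 m \<tau>) [2, 1, 4, 3] \<longleftrightarrow>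
    contains_pattern m \<tau> [2, 1, 4, 3]"
proof
  let ?\<pi> = "[2, 1, 4, 3] :: nat list"
  assume "contains_pattern (2 * 1 + m) (sandwich (flip 1) 1 m \<tau>) ?\<pi>"
  then obtain p q where p: "p \<le> length ?\<pi>" "splits_at ?\<pi> p" "contains_pattern 1 (flip 1) (take p ?\<pi>)"
    and q: "q \<le> length ?\<pi> - p" "splits_at (drop p ?\<pi>) q" "contains_pattern m \<tau> (take q (drop p ?\<pi>))"
    and r: "contains_pattern 1 (flip 1) (drop (p + q) ?\<pi>)"
    unfolding contains_sandwich[OF flip_ci \<tau>] by blast
  have "p \<le> 1"
    using p(1,3) unfolding contains_pattern_flip by simp
  moreover have "\<not> splits_at ?\<pi> 1"
    unfolding splits_at_def by (intro notI) (drule spec[of _ 0], simp add: numeral_eq_Suc All_less_Suc)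
  ultimately have "p = 0"
    using p(2) by (cases p) auto
  then have "3 \<le> q" "q \<le> 4"
    using q(1) r unfolding contains_pattern_flip by auto
  moreover have "\<not> splits_at ?\<pi> 3"
    unfolding splits_at_def by (intro notI) (drule spec[of _ 2], simp add: numeral_eq_Suc All_less_Suc)
  ultimately have "q = 4"
    using q(2) \<open>p = 0\<close> by (cases "q = 3") auto
  with q(3) \<open>p = 0\<close> show "contains_pattern m \<tau> ?\<pi>"
    by simp
qed (rule contains_sandwich_middle[OF flip_ci \<tau>])

text \<open>A first block of size at least two and its mirror image contribute two descents, one after
  and above the other, which form 2143. So the first block is a point unless it is the only block.\<close>

lemma CI_2143_312:
  assumes n: "2 \<le> n"
  shows "CI n {[2, 1, 4, 3], [3, 1, 2]} =
    insert (flip n) (sandwich (flip 1) 1 (n - 2) ` CI (n - 2) {[2, 1, 4, 3], [3, 1, 2]})"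
    (is "CI n ?P = insert _ (?S ` _)")
proof -
  have S: "?S \<tau> \<in> CI n ?P \<longleftrightarrow> \<tau> \<in> CI (n - 2) ?P"
    if \<tau>: "\<tau> \<in> centrosymmetric_involutions (n - 2)" for \<tau>
  proof -
    have n': "2 * 1 + (n - 2) = n"
      using n by simp
    have "?S \<tau> \<in> centrosymmetric_involutions n"
      using sandwich_ci[OF flip_ci \<tau>, of 1] unfolding n' .
    moreover have "contains_pattern n (?S \<tau>) [2, 1, 4, 3] \<longleftrightarrow> contains_pattern (n - 2) \<tau> [2, 1, 4, 3]"
      using sandwich_point_contains_2143[OF \<tau>] unfolding n' .
    moreover have "contains_pattern n (?S \<tau>) [3, 1, 2] \<longleftrightarrow> contains_pattern (n - 2) \<tau> [3, 1, 2]"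
      using contains_sandwich_indecomposable[OF sum_indecomposable_patterns(1) flip_ci \<tau>, of 1]
      unfolding n' contains_pattern_flip by simp
    ultimately show ?thesis
      using \<tau> unfolding CI_def by blast
  qed
  have "\<tau> = flip n \<or> \<tau> \<in> ?S ` CI (n - 2) ?P" if "\<tau> \<in> CI n ?P" for \<tau>
  proof -
    have \<tau>: "\<tau> \<in> centrosymmetric_involutions n" "\<not> contains_pattern n \<tau> [3, 1, 2]"
      "\<not> contains_pattern n \<tau> [2, 1, 4, 3]" and n1: "1 \<le> n"
      using that n unfolding CI_def by auto
    from \<tau>(1,2) n1 show ?thesis
    proof (cases rule: CI_312_cases)
      case (2 j \<tau>')
      define m where "m = n - 2 * j"
      have n_eq: "n = 2 * j + m"
        using 2(1) by (auto simp: m_def)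
      have "j = 1"
      proof (rule ccontr)
        assume "j \<noteq> 1"
        then have j: "2 \<le> j"
          using 2(1) by auto
        have "j + m + (j - 1) = n - 1" "j + m + j = n"
          using j by (auto simp: n_eq)
        then have "\<tau> 1 = j" "\<tau> 2 = j - 1" "\<tau> (n - 1) = j + m + 2" "\<tau> n = j + m + 1"
          using j sandwich_right[of j "flip j" j m \<tau>'] sandwich_right[of "j - 1" "flip j" j m \<tau>']
          by (auto simp: 2(3) m_def[symmetric] sandwich_left flip_def)
        then have "(1::nat) < 2" "2 < n - 1" "n - 1 < n" "\<tau> 2 < \<tau> 1" "\<tau> 1 < \<tau> n" "\<tau> n < \<tau> (n - 1)"
          using j by (auto simp: n_eq)
        then have "contains_pattern n \<tau> [2, 1, 4, 3]"
          unfolding contains_2143 using le_refl[of 1] le_refl[of n] by blast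
        with \<tau>(3) show False ..
      qed
      with 2(2,3) have "\<tau>' \<in> centrosymmetric_involutions (n - 2)" "\<tau> = ?S \<tau>'"
        by auto
      then show ?thesis
        using S[of \<tau>'] that by blast
    qed blast
  qed
  moreover have "flip n \<in> CI n ?P"
    by (simp add: flip_CI_iff)
  moreover have "?S \<tau> \<in> CI n ?P" if "\<tau> \<in> CI (n - 2) ?P" for \<tau>
    using S[of \<tau>] that unfolding CI_def by blast
  ultimately show ?thesis
    by blast
qed

lemma card_CI_2143_312: "card (CI n {[2, 1, 4, 3], [3, 1, 2]}) = n div 2 + 1"
proof (induction n rule: induct_nat_012)
  case 1
  have "\<tau> = id" if "\<tau> \<in> centrosymmetric_involutions 1" for \<tau>
  proof
    fix i
    show "\<tau> i = id i"
      using that by (cases "i = 1") (auto simp: centrosymmetric_involutions_iff)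
  qed
  then have "centrosymmetric_involutions 1 = {id}"
    by (auto simp: centrosymmetric_involutions_iff)
  moreover have "\<not> contains_pattern 1 id [2, 1, 4, 3]" "\<not> contains_pattern 1 id [3, 1, 2]"
    unfolding contains_2143 contains_312 by auto
  ultimately have "CI 1 {[2, 1, 4, 3], [3, 1, 2]} = {id}"
    by (auto simp: CI_def)
  then show ?case
    by simp
next
  case (ge2 n)
  let ?P = "{[2, 1, 4, 3], [3, 1, 2]} :: nat list set" and ?S = "sandwich (flip 1) 1 n"
  have "inj_on ?S (CI n ?P)"
    unfolding CI_def by (blast intro: inj_onI sandwich_inject)
  moreover have "flip (Suc (Suc n)) \<notin> ?S ` CI n ?P"
    using flip_neq_sandwich[of 1 "Suc (Suc n)"] by auto
  moreover have "CI (Suc (Suc n)) ?P = insert (flip (Suc (Suc n))) (?S ` CI n ?P)"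
    using CI_2143_312[of "Suc (Suc n)"] by simp
  ultimately show ?case
    using ge2 by (simp add: card_image)
qed (simp add: CI_0)

section \<open>Reversal of the classes avoiding 132\<close>

lemma CI_231_eq_312: "CI n {\<pi>, [2, 3, 1]} = CI n {\<pi>, [3, 1, 2]}"
  unfolding CI_def using ci_contains_231_iff by blast

theorem card_CI_4321_132: "card (CI n {[4, 3, 2, 1], [1, 3, 2]}) = n div 2 + 1"
proof -
  have "card (CI n {[4, 3, 2, 1], [1, 3, 2]}) = card (CI n {[1, 2, 3, 4], [2, 3, 1]})"
    using card_CI_reverse[of n "{[4, 3, 2, 1], [1, 3, 2]}"] by simp
  then show ?thesis
    unfolding CI_231_eq_312 card_CI_1234_312 .
qed

theorem card_CI_3412_132: "card (CI n {[3, 4, 1, 2], [1, 3, 2]}) = n div 2 + 1"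
proof -
  have "card (CI n {[3, 4, 1, 2], [1, 3, 2]}) = card (CI n {[2, 1, 4, 3], [2, 3, 1]})"
    using card_CI_reverse[of n "{[3, 4, 1, 2], [1, 3, 2]}"] by simp
  then show ?thesis
    unfolding CI_231_eq_312 card_CI_2143_312 .
qed

section \<open>Open matchings\<close>

text \<open>The possible left halves of involutions avoiding 321. The value 0, which is no position, marks
  the left end of an arc that leaves the half. Such an arc counts as longer than all others,
  and the last clause says that arcs do not nest and do not pass over fixed points.\<close>

definition open_matchings :: "nat \<Rightarrow> (nat \<Rightarrow> nat) set" where
  "open_matchings h = {p. (\<forall>i. i \<notin> {1..h} \<longrightarrow> p i = 0) \<and>
     (\<forall>i\<in>{1..h}. p i \<le> h \<and> (p i \<noteq> 0 \<longrightarrow> p (p i) = i)) \<and>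
     (\<forall>i\<in>{1..h}. \<forall>j\<in>{1..h}. i < j \<longrightarrow> j \<le> p j \<longrightarrow> 0 < p i \<and> p i < p j)}"

definition open_positions :: "nat \<Rightarrow> (nat \<Rightarrow> nat) \<Rightarrow> nat set" where
  "open_positions h p = {i \<in> {1..h}. p i = 0}"

context
  fixes h p
  assumes p: "p \<in> open_matchings h"
begin

lemma om_outside: "i \<notin> {1..h} \<Longrightarrow> p i = 0"
  using p by (simp add: open_matchings_def)

lemma om_le: "p i \<le> h"
  using p by (cases "i \<in> {1..h}") (auto simp: open_matchings_def)

lemma om_invol: "p i \<noteq> 0 \<Longrightarrow> p (p i) = i"
  using p by (cases "i \<in> {1..h}") (auto simp: open_matchings_def)

lemma om_mono:
  assumes "1 \<le> i" "i < j" "j \<le> p j"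
  shows "0 < p i \<and> p i < p j"
proof -
  have "j \<in> {1..h}"
    using om_outside[of j] assms by (cases "j \<in> {1..h}") auto
  moreover from this have "i \<in> {1..h}"
    using assms by simp
  ultimately show ?thesis
    using p assms unfolding open_matchings_def by blast
qed

end

lemma finite_open_positions [simp]: "finite (open_positions h p)"
  by (simp add: open_positions_def)

text \<open>The new position \<open>Suc h\<close> closes the earliest open arc. It belongs to \<open>open_positions (Suc h) p\<close>
  itself, so it is the minimum, and becomes a fixed point, if no arc is open before.\<close>

definition seal :: "nat \<Rightarrow> (nat \<Rightarrow> nat) \<Rightarrow> nat \<Rightarrow> nat" where
  "seal h p = (let m = Min (open_positions (Suc h) p) in p(m := Suc h, Suc h := m))"

lemma open_positions_Suc:
  assumes "p \<in> open_matchings h"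
  shows "open_positions (Suc h) p = insert (Suc h) (open_positions h p)"
  using om_outside[OF assms] by (auto simp: open_positions_def le_Suc_eq)

lemma open_matchings_mono: "open_matchings h \<subseteq> open_matchings (Suc h)"
proof
  fix p assume p: "p \<in> open_matchings h"
  show "p \<in> open_matchings (Suc h)"
    unfolding open_matchings_def mem_Collect_eq
    using om_outside[OF p] om_le[OF p] om_invol[OF p] om_mono[OF p] by (auto simp: le_SucI)
qed

lemma seal_first:
  assumes p: "p \<in> open_matchings h"
  obtains m where "m = Min (open_positions (Suc h) p)" "seal h p = p(m := Suc h, Suc h := m)"
    "m \<in> {1..Suc h}" "p m = 0" "\<And>i. 1 \<le> i \<Longrightarrow> i < m \<Longrightarrow> p i \<noteq> 0"
proof -
  define m where "m = Min (open_positions (Suc h) p)"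
  have "Suc h \<in> open_positions (Suc h) p"
    using open_positions_Suc[OF p] by simp
  then have m: "m \<in> open_positions (Suc h) p"
    unfolding m_def by (intro Min_in) auto
  have "p i \<noteq> 0" if "1 \<le> i" "i < m" for i
  proof
    assume "p i = 0"
    then have "i \<in> open_positions (Suc h) p"
      using that m by (auto simp: open_positions_def)
    then have "m \<le> i"
      unfolding m_def by (intro Min_le) auto
    with that show False by simp
  qed
  moreover have "m \<in> {1..Suc h}" "p m = 0"
    using m by (auto simp: open_positions_def)
  moreover have "seal h p = p(m := Suc h, Suc h := m)"
    by (simp add: seal_def Let_def m_def)
  ultimately show thesis
    using that m_def by blast
qed

text \<open>Closing the earliest open arc is safe: all positions before its left end have finite
  partners, which lie to the left of the new position.\<close>

lemma seal_open_matching: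
  assumes p: "p \<in> open_matchings h"
  shows "seal h p \<in> open_matchings (Suc h)"
proof -
  obtain m where m: "seal h p = p(m := Suc h, Suc h := m)" "m \<in> {1..Suc h}" "p m = 0"
    "\<And>i. 1 \<le> i \<Longrightarrow> i < m \<Longrightarrow> p i \<noteq> 0"
    using seal_first[OF p] by metis
  have avoid_m: "p i \<noteq> m" if "i \<noteq> 0" for i
    using om_invol[OF p, of i] m(2,3) that by fastforce
  have "0 < seal h p i \<and> seal h p i < seal h p j"
    if ij: "1 \<le> i" "i < j" "j \<le> Suc h" "j \<le> seal h p j" for i j
  proof -
    consider "j = Suc h" "m = Suc h" | "j = m" "m \<le> h" | "j \<noteq> m" "j \<le> h" "j \<le> p j"
      using ij(3,4) m(1,2) by (fastforce split: if_splits)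
    then show ?thesis
    proof cases
      case 1
      then have "i \<noteq> m" "i \<noteq> Suc h" "p i \<noteq> 0"
        using ij m(4) by auto
      then show ?thesis
        using 1 m(1) om_le[OF p, of i] by simp
    next
      case 2
      then have "i \<noteq> m" "i \<noteq> Suc h" "p i \<noteq> 0"
        using ij m(4) by auto
      then show ?thesis
        using 2 m(1) om_le[OF p, of i] by simp
    next
      case 3
      then have "0 < p i \<and> p i < p j"
        using om_mono[OF p ij(1,2)] by blast
      moreover from this have "i \<noteq> m" "i \<noteq> Suc h" "j \<noteq> Suc h"
        using m(3) 3 ij by auto
      ultimately show ?thesis
        using 3 m(1) by simp
    qed
  qed
  moreover have "seal h p i = 0" if "i \<notin> {1..Suc h}" for i
    using that m(1,2) om_outside[OF p, of i] by auto
  moreover have "seal h p i \<le> Suc h \<and> (seal h p i \<noteq> 0 \<longrightarrow> seal h p (seal h p i) = i)"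
    if "i \<in> {1..Suc h}" for i
  proof -
    have "p i \<noteq> Suc h" "p i \<le> Suc h"
      using om_le[OF p, of i] by auto
    then show ?thesis
      using that m(1,2) om_invol[OF p, of i] avoid_m[of i] by auto
  qed
  ultimately show ?thesis
    unfolding open_matchings_def mem_Collect_eq by auto
qed

text \<open>If there is no open arc, sealing creates a fixed point and the truncated difference stays 0.\<close>

lemma open_positions_seal:
  assumes p: "p \<in> open_matchings h"
  shows "card (open_positions (Suc h) (seal h p)) = card (open_positions h p) - 1"
proof -
  obtain m where m: "m = Min (open_positions (Suc h) p)" "seal h p = p(m := Suc h, Suc h := m)"
    "m \<in> {1..Suc h}" "p m = 0"
    using seal_first[OF p] by metis
  have pos: "open_positions (Suc h) (seal h p) = open_positions h p - {m}"
    using m(2,3) by (auto simp: open_positions_def le_Suc_eq)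
  show ?thesis
  proof (cases "open_positions h p = {}")
    case False
    then have "m \<noteq> Suc h"
      using m(1) open_positions_Suc[OF p] Min_in[of "open_positions h p"]
      by (auto simp: min_def open_positions_def)
    then have "m \<in> open_positions h p"
      using m by (auto simp: open_positions_def)
    then show ?thesis
      unfolding pos by simp
  qed (simp add: pos)
qed

text \<open>The sealed arc is the one at \<open>Suc h\<close>, so reopening it recovers the original.\<close>

lemma seal_inject:
  assumes p: "p \<in> open_matchings h" and q: "q \<in> open_matchings h" and eq: "seal h p = seal h q"
  shows "p = q"
proof -
  have unseal: "r = (seal h r)(seal h r (Suc h) := 0, Suc h := 0)" if r: "r \<in> open_matchings h" for r
  proof -
    obtain m where "seal h r = r(m := Suc h, Suc h := m)" "r m = 0"
      using seal_first[OF r] by metis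
    then show ?thesis
      using om_outside[OF r, of "Suc h"] by (auto simp: fun_eq_iff)
  qed
  show ?thesis
    using unseal[OF p] unseal[OF q] eq by simp
qed

text \<open>If the last position is the right end of an arc or a fixed point, its partner has to be the
  earliest open position: an open arc that starts before the partner would enclose the closed one.\<close>

lemma open_matchings_Suc: "open_matchings (Suc h) = open_matchings h \<union> seal h ` open_matchings h"
proof (intro equalityI subsetI)
  fix q assume q: "q \<in> open_matchings (Suc h)"
  show "q \<in> open_matchings h \<union> seal h ` open_matchings h"
  proof (cases "q (Suc h) = 0")
    case True
    have "q i \<noteq> Suc h" for i
      using om_invol[OF q, of i] om_outside[OF q, of 0] True by fastforce
    then have "q i \<le> h" for i
      using om_le[OF q, of i] by (metis le_SucE)
    moreover have "q i = 0" if "i \<notin> {1..h}" for i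
      using om_outside[OF q, of i] True that by (cases "i = Suc h") auto
    ultimately have "q \<in> open_matchings h"
      unfolding open_matchings_def mem_Collect_eq using om_invol[OF q] om_mono[OF q] by auto
    then show ?thesis by blast
  next
    case False
    define m where "m = q (Suc h)"
    have m: "m \<noteq> 0" "q m = Suc h" "m \<le> Suc h"
      using False om_invol[OF q, of "Suc h"] om_le[OF q, of "Suc h"] by (auto simp: m_def)
    define p where "p = q(m := 0, Suc h := 0)"
    have before: "0 < q i" if "1 \<le> i" "i < m" for i
      using om_mono[OF q that] m by simp
    have p_eq: "p i = (if i = m \<or> i = Suc h then 0 else q i)" for i
      by (simp add: p_def)
    have range: "q i \<noteq> m \<and> q i \<noteq> Suc h" if "i \<noteq> m" "i \<noteq> Suc h" for i
      using om_invol[OF q, of i] m that by (metis m_def nat.distinct(1))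
    have p: "p \<in> open_matchings h"
      unfolding open_matchings_def mem_Collect_eq
    proof (intro conjI allI ballI impI)
      fix i assume "i \<notin> {1..h}"
      then show "p i = 0"
        using om_outside[OF q, of i] by (cases "i = Suc h") (auto simp: p_eq)
    next
      fix i assume "i \<in> {1..h}"
      then show "p i \<le> h"
        using om_le[OF q, of i] range[of i] by (auto simp: p_eq le_Suc_eq)
      assume "p i \<noteq> 0"
      then show "p (p i) = i"
        using om_invol[OF q, of i] range[of i] by (auto simp: p_eq split: if_splits)
    next
      fix i j assume ij: "i \<in> {1..h}" "j \<in> {1..h}" "i < j" "j \<le> p j"
      then have j: "j \<noteq> m" "j \<le> q j" "p j = q j"
        by (auto simp: p_eq split: if_splits)
      then have less: "0 < q i" "q i < q j"
        using om_mono[OF q, of i j] ij by auto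
      then have "i \<noteq> m"
        using om_le[OF q, of j] m by auto
      then show "0 < p i" "p i < p j"
        using less j ij by (auto simp: p_eq)
    qed
    have "Min (open_positions (Suc h) p) = m"
    proof (rule Min_eqI)
      show "m \<in> open_positions (Suc h) p"
        using m by (auto simp: open_positions_def p_eq)
      show "m \<le> i" if "i \<in> open_positions (Suc h) p" for i
        using that before[of i] m(3) by (force simp: open_positions_def p_eq split: if_splits)
    qed simp
    then have "seal h p = q"
      using m(2) by (auto simp: seal_def Let_def p_eq fun_eq_iff m_def[symmetric])
    with p show ?thesis by blast
  qed
qed (use open_matchings_mono seal_open_matching in auto)

lemma seal_not_open:
  assumes "p \<in> open_matchings h"
  shows "seal h p \<notin> open_matchings h"
proof
  assume "seal h p \<in> open_matchings h"
  then have "seal h p (Suc h) = 0"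
    by (rule om_outside) simp
  moreover obtain m where "seal h p = p(m := Suc h, Suc h := m)" "m \<in> {1..Suc h}"
    using seal_first[OF assms] by metis
  ultimately show False by simp
qed

lemma open_matchings_0: "open_matchings 0 = {\<lambda>_. 0}"
  by (auto simp: open_matchings_def)

lemma finite_open_matchings [simp]: "finite (open_matchings h)"
  by (induction h) (simp_all add: open_matchings_0 open_matchings_Suc)

theorem card_open_matchings: "card (open_matchings h) = 2 ^ h"
proof (induction h)
  case (Suc h)
  have "card (open_matchings (Suc h)) = card (open_matchings h) + card (seal h ` open_matchings h)"
    unfolding open_matchings_Suc using seal_not_open by (intro card_Un_disjoint) auto
  also have "card (seal h ` open_matchings h) = card (open_matchings h)"
    using seal_inject by (intro card_image inj_onI) blast
  finally show ?case
    using Suc by simp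
qed (simp add: open_matchings_0)

text \<open>The first summand counts the halves in which the new position stays open, the second one
  those in which it has been sealed. The truncated difference covers new fixed points.\<close>

lemma card_open_matchings_Suc:
  "card {q \<in> open_matchings (Suc h). card (open_positions (Suc h) q) = k} =
     card {p \<in> open_matchings h. card (open_positions h p) + 1 = k} +
     card {p \<in> open_matchings h. card (open_positions h p) - 1 = k}"
proof -
  have open_card: "card (open_positions (Suc h) p) = card (open_positions h p) + 1"
    if "p \<in> open_matchings h" for p
  proof -
    have "Suc h \<notin> open_positions h p"
      by (simp add: open_positions_def)
    then show ?thesis
      using open_positions_Suc[OF that] by simp
  qed
  let ?A = "{p \<in> open_matchings h. card (open_positions h p) + 1 = k}"
  let ?B = "{p \<in> open_matchings h. card (open_positions h p) - 1 = k}"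
  have "{q \<in> open_matchings (Suc h). card (open_positions (Suc h) q) = k} = ?A \<union> seal h ` ?B"
    unfolding open_matchings_Suc using open_card open_positions_seal by auto
  moreover have "card (?A \<union> seal h ` ?B) = card ?A + card (seal h ` ?B)"
    using seal_not_open by (intro card_Un_disjoint) auto
  moreover have "card (seal h ` ?B) = card ?B"
    using seal_inject by (intro card_image inj_onI) blast
  ultimately show ?thesis
    by simp
qed

text \<open>The number of open arcs moves up or down by one, except that it may also stay at 0. For
  positive \<open>k\<close> the recurrence is Pascal's rule; for \<open>k = 0\<close> this holds up to the symmetry of the
  binomial coefficients.\<close>

lemma card_open_matchings_open_positions:
  "card {p \<in> open_matchings h. card (open_positions h p) = k} = h choose ((h + k + 1) div 2)"
proof (induction h arbitrary: k)
  case 0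
  have "open_positions 0 p = {}" for p
    by (simp add: open_positions_def)
  then show ?case
    by (cases k) (auto simp: open_matchings_0 binomial_eq_0)
next
  case (Suc h)
  let ?N = "\<lambda>k. card {p \<in> open_matchings h. card (open_positions h p) = k}"
  show ?case
  proof (cases k)
    case 0
    have "{p \<in> open_matchings h. card (open_positions h p) - 1 = 0} =
        {p \<in> open_matchings h. card (open_positions h p) = 0} \<union>
        {p \<in> open_matchings h. card (open_positions h p) = 1}"
      by (auto simp del: card_0_eq card_eq_0_iff)
    then have "card {p \<in> open_matchings h. card (open_positions h p) - 1 = 0} = ?N 0 + ?N 1"
      by (simp only:) (intro card_Un_disjoint, auto)
    then have "card {q \<in> open_matchings (Suc h). card (open_positions (Suc h) q) = 0} = ?N 0 + ?N 1"
      unfolding card_open_matchings_Suc by simp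
    also have "\<dots> = (h choose ((h + 1) div 2)) + (h choose (h div 2 + 1))"
      unfolding Suc.IH by simp
    also have "h choose ((h + 1) div 2) = h choose (h div 2)"
      by (subst binomial_symmetric) (auto intro!: arg_cong[of _ _ "(choose) h"])
    also have "(h choose (h div 2)) + (h choose (h div 2 + 1)) = Suc h choose (h div 2 + 1)"
      by simp
    finally show ?thesis
      using 0 by simp
  next
    case (Suc k')
    have "card (open_positions h p) - 1 = k \<longleftrightarrow> card (open_positions h p) = k' + 2" for p
      using Suc by auto
    then have "card {q \<in> open_matchings (Suc h). card (open_positions (Suc h) q) = k} =
        ?N k' + ?N (k' + 2)"
      unfolding card_open_matchings_Suc using Suc by simp
    also have "\<dots> = (h choose ((h + k' + 1) div 2)) + (h choose ((h + k' + 1) div 2 + 1))"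
      unfolding Suc.IH by simp
    also have "\<dots> = Suc h choose ((h + k' + 1) div 2 + 1)"
      by simp
    finally show ?thesis
      using Suc by simp
  qed
qed

lemma card_closed_matchings:
  "card {p \<in> open_matchings h. open_positions h p = {}} = h choose (h div 2)"
proof -
  have "{p \<in> open_matchings h. open_positions h p = {}} =
      {p \<in> open_matchings h. card (open_positions h p) = 0}"
    by simp
  also have "card \<dots> = h choose ((h + 1) div 2)"
    unfolding card_open_matchings_open_positions by simp
  also have "h choose ((h + 1) div 2) = h choose (h div 2)"
    by (subst binomial_symmetric) (auto intro!: arg_cong[of _ _ "(choose) h"])
  finally show ?thesis .
qed

section \<open>Involutions avoiding 321 and their left halves\<close>

text \<open>If \<open>i < j \<le> \<tau> j < \<tau> i\<close>, then the values at \<open>i, j, \<tau> i\<close> form 321. Conversely, consider an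
  occurrence at \<open>a < b < c\<close>: if \<open>b \<le> \<tau> b\<close>, then monotonicity fails at \<open>a, b\<close>, and otherwise at
  the images \<open>\<tau> c < \<tau> b\<close>.\<close>

lemma ci_avoids_321_iff:
  assumes \<tau>: "\<tau> \<in> centrosymmetric_involutions n"
  shows "\<not> contains_pattern n \<tau> [3, 2, 1] \<longleftrightarrow>
    (\<forall>i j. 1 \<le> i \<longrightarrow> i < j \<longrightarrow> j \<le> n \<longrightarrow> j \<le> \<tau> j \<longrightarrow> \<tau> i < \<tau> j)"
    (is "?L \<longleftrightarrow> ?R")
proof (intro iffI allI impI)
  fix i j assume ?L and ij: "1 \<le> i" "i < j" "j \<le> n" "j \<le> \<tau> j"
  show "\<tau> i < \<tau> j"
  proof (rule ccontr)
    assume "\<not> \<tau> i < \<tau> j"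
    moreover have "\<tau> i \<noteq> \<tau> j"
      using ij(2) by (simp add: ci_eq_iff[OF \<tau>])
    ultimately have "\<tau> j < \<tau> i" "j < \<tau> i" "\<tau> i \<le> n" "\<tau> (\<tau> i) < \<tau> j"
      using ij ci_bounds[OF \<tau>, of i] by (auto simp: ci_invol[OF \<tau>])
    with ij(1,2) have "contains_pattern n \<tau> [3, 2, 1]"
      unfolding contains_321 by blast
    with \<open>?L\<close> show False ..
  qed
next
  assume R: ?R
  show ?L
  proof
    assume "contains_pattern n \<tau> [3, 2, 1]"
    then obtain a b c where abc: "1 \<le> a" "a < b" "b < c" "c \<le> n" "\<tau> c < \<tau> b" "\<tau> b < \<tau> a"
      unfolding contains_321 by blast
    then have "\<tau> b < b"
      using R[rule_format, of a b] by (cases "b \<le> \<tau> b") auto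
    moreover have "1 \<le> \<tau> c" "\<tau> b \<le> n"
      using ci_bounds[OF \<tau>, of c] ci_bounds[OF \<tau>, of b] abc by auto
    moreover have "\<tau> b \<le> \<tau> (\<tau> b)"
      using \<open>\<tau> b < b\<close> by (simp add: ci_invol[OF \<tau>])
    ultimately have "\<tau> (\<tau> c) < \<tau> (\<tau> b)"
      using R abc(5) by blast
    with abc(3) show False
      by (simp add: ci_invol[OF \<tau>])
  qed
qed

lemma CI_321_D:
  assumes "\<tau> \<in> CI n {[3, 2, 1]}"
  shows "\<tau> \<in> centrosymmetric_involutions n"
    and "1 \<le> i \<Longrightarrow> i < j \<Longrightarrow> j \<le> n \<Longrightarrow> j \<le> \<tau> j \<Longrightarrow> \<tau> i < \<tau> j"
proof -
  show \<tau>: "\<tau> \<in> centrosymmetric_involutions n"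
    using assms by (simp add: CI_def)
  have "\<not> contains_pattern n \<tau> [3, 2, 1]"
    using assms unfolding CI_def by blast
  then show "1 \<le> i \<Longrightarrow> i < j \<Longrightarrow> j \<le> n \<Longrightarrow> j \<le> \<tau> j \<Longrightarrow> \<tau> i < \<tau> j"
    unfolding ci_avoids_321_iff[OF \<tau>] by blast
qed

text \<open>The value 0 stands for a partner beyond the left half; a middle position belongs to neither
  half.\<close>

definition half :: "nat \<Rightarrow> (nat \<Rightarrow> nat) \<Rightarrow> nat \<Rightarrow> nat" where
  "half n \<tau> i = (if i \<in> {1..n div 2} \<and> \<tau> i \<le> n div 2 then \<tau> i else 0)"

lemma half_open_matching:
  assumes "\<tau> \<in> CI n {[3, 2, 1]}"
  shows "half n \<tau> \<in> open_matchings (n div 2)"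
proof -
  note \<tau> = CI_321_D[OF assms]
  have "half n \<tau> (half n \<tau> i) = i" if "half n \<tau> i \<noteq> 0" for i
  proof -
    have i: "i \<in> {1..n div 2}" "\<tau> i \<le> n div 2"
      using that by (auto simp: half_def split: if_splits)
    then have "\<tau> i \<in> {1..n div 2}"
      using ci_bounds[OF \<tau>(1), of i] by auto
    with i show ?thesis
      by (simp add: half_def ci_invol[OF \<tau>(1)])
  qed
  moreover have "0 < half n \<tau> i \<and> half n \<tau> i < half n \<tau> j"
    if ij: "i \<in> {1..n div 2}" "j \<in> {1..n div 2}" "i < j" "j \<le> half n \<tau> j" for i j
  proof -
    have j: "half n \<tau> j = \<tau> j" "\<tau> j \<le> n div 2"
      using ij(2,4) by (auto simp: half_def split: if_splits)
    then have "\<tau> i < \<tau> j"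
      using \<tau>(2)[of i j] ij by auto
    moreover have "1 \<le> i" "i \<le> n"
      using ij(1) by auto
    then have "0 < \<tau> i"
      using ci_bounds[OF \<tau>(1), of i] by simp
    ultimately show ?thesis
      using j ij(1) by (simp add: half_def)
  qed
  moreover have "half n \<tau> i = 0" if "i \<notin> {1..n div 2}" for i
    using that by (auto simp: half_def)
  moreover have "half n \<tau> i \<le> n div 2" for i
    by (simp add: half_def)
  ultimately show ?thesis
    unfolding open_matchings_def mem_Collect_eq by blast
qed

lemma open_positions_half:
  assumes "\<tau> \<in> centrosymmetric_involutions n"
  shows "open_positions (n div 2) (half n \<tau>) = {i \<in> {1..n div 2}. n div 2 < \<tau> i}"
proof -
  have pos: "\<tau> i \<noteq> 0" if "i \<in> {1..n div 2}" for i
  proof -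
    have "1 \<le> i" "i \<le> n"
      using that by auto
    then show ?thesis
      using ci_bounds[OF assms, of i] by simp
  qed
  show ?thesis
    by (auto simp: open_positions_def half_def pos)
qed

text \<open>The middle position is fixed, and no arc may pass over it.\<close>

lemma open_positions_half_odd:
  assumes "\<tau> \<in> CI n {[3, 2, 1]}" "odd n"
  shows "open_positions (n div 2) (half n \<tau>) = {}"
proof -
  note \<tau> = CI_321_D[OF assms(1)]
  define c where "c = n div 2 + 1"
  have c: "c \<in> {1..n}" "n + 1 - c = c" "n + 1 = 2 * c"
    using assms(2) by (auto simp: c_def elim!: oddE)
  then have "\<tau> c = c"
    using ci_mirror[OF \<tau>(1) c(1)] ci_closed[OF \<tau>(1) c(1)] by simp
  then have "\<tau> i < c" if "i \<in> {1..n div 2}" for i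
    using \<tau>(2)[of i c] that c(1) by (simp add: c_def)
  then show ?thesis
    unfolding open_positions_half[OF \<tau>(1)] by (force simp: c_def)
qed

text \<open>The arcs across the middle send the set of their left ends to the mirror image of this set,
  and they preserve the order. Reflecting the right ends thus gives an order-reversing self-map of
  this finite set, and there is only one such map.\<close>

lemma half_inject:
  assumes "\<tau> \<in> CI n {[3, 2, 1]}" "\<tau>' \<in> CI n {[3, 2, 1]}" and eq: "half n \<tau> = half n \<tau>'"
  shows "\<tau> = \<tau>'"
proof
  note \<tau> = CI_321_D[OF assms(1)] and \<tau>' = CI_321_D[OF assms(2)]
  define h U where "h = n div 2" and "U = open_positions h (half n \<tau>)"
  have h: "2 * h \<le> n"
    by (simp add: h_def)
  have U: "U = {i \<in> {1..h}. h < \<tau> i}" "U = {i \<in> {1..h}. h < \<tau>' i}"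
    using open_positions_half[OF \<tau>(1)] open_positions_half[OF \<tau>'(1)] eq by (simp_all add: h_def U_def)
  have anti: "(\<lambda>i. n + 1 - \<sigma> i) ` U \<subseteq> U"
    "\<And>x y. x \<in> U \<Longrightarrow> y \<in> U \<Longrightarrow> x < y \<Longrightarrow> n + 1 - \<sigma> y < n + 1 - \<sigma> x"
    if even: "n = 2 * h" and \<sigma>: "\<sigma> \<in> CI n {[3, 2, 1]}" "U = {i \<in> {1..h}. h < \<sigma> i}" for \<sigma>
  proof -
    note \<sigma>' = CI_321_D[OF \<sigma>(1)]
    have bounds: "1 \<le> \<sigma> i" "\<sigma> i \<le> n" if "i \<in> U" for i
      using ci_bounds[OF \<sigma>'(1), of i] that h by (auto simp: \<sigma>(2))
    show "(\<lambda>i. n + 1 - \<sigma> i) ` U \<subseteq> U"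
    proof (rule image_subsetI)
      fix i assume i: "i \<in> U"
      have "\<sigma> (n + 1 - \<sigma> i) = n + 1 - i"
        using ci_mirror[OF \<sigma>'(1), of "\<sigma> i"] bounds[OF i] by (simp add: ci_invol[OF \<sigma>'(1)])
      then show "n + 1 - \<sigma> i \<in> U"
        using i bounds[OF i] even by (auto simp: \<sigma>(2))
    qed
    fix x y assume xy: "x \<in> U" "y \<in> U" "x < y"
    then have "\<sigma> x < \<sigma> y"
      using \<sigma>'(2)[of x y] h by (auto simp: \<sigma>(2))
    then show "n + 1 - \<sigma> y < n + 1 - \<sigma> x"
      using bounds[OF xy(2)] by simp
  qed
  have lower: "\<tau> i = \<tau>' i" if i: "i \<in> {1..h}" for i
  proof (cases "i \<in> U")
    case True
    then have "even n"
      using open_positions_half_odd[OF assms(1)] by (auto simp: U_def h_def)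
    then have n: "n = 2 * h"
      by (simp add: h_def)
    have "finite U"
      by (simp add: U_def)
    from strict_antimono_self_map_unique[OF this anti[OF n assms(1) U(1)] anti[OF n assms(2) U(2)] True]
    have "n + 1 - \<tau> i = n + 1 - \<tau>' i" .
    then show ?thesis
      using ci_bounds[OF \<tau>(1), of i] ci_bounds[OF \<tau>'(1), of i] i h by auto
  next
    case False
    have "\<not> h < \<tau> i"
      using False i unfolding U(1) by blast
    moreover have "\<not> h < \<tau>' i"
      using False i unfolding U(2) by blast
    ultimately show ?thesis
      using fun_cong[OF eq, of i] i by (simp add: half_def h_def)
  qed
  fix i
  consider "i \<notin> {1..n}" | "i \<in> {1..h}" | "i \<in> {1..n}" "n + 1 - i \<in> {1..h}" | "i \<in> {1..n}" "n + 1 - i = i"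
    unfolding atLeastAtMost_iff h_def by linarith
  then show "\<tau> i = \<tau>' i"
  proof cases
    case 1
    then show ?thesis
      by (simp add: ci_fixes_outside[OF \<tau>(1)] ci_fixes_outside[OF \<tau>'(1)])
  next
    case 2
    then show ?thesis
      by (rule lower)
  next
    case 3
    then have "n + 1 - \<tau> i = n + 1 - \<tau>' i"
      using lower[OF 3(2)] ci_mirror[OF \<tau>(1) 3(1)] ci_mirror[OF \<tau>'(1) 3(1)] by simp
    then show ?thesis
      using ci_closed[OF \<tau>(1) 3(1)] ci_closed[OF \<tau>'(1) 3(1)] by auto
  next
    case 4
    then show ?thesis
      using ci_mirror[OF \<tau>(1) 4(1)] ci_mirror[OF \<tau>'(1) 4(1)]
        ci_closed[OF \<tau>(1) 4(1)] ci_closed[OF \<tau>'(1) 4(1)] by auto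
  qed
qed

text \<open>Every open arc is joined to a position in the right half. Reflected to the left half, the
  right ends are given by the order-reversing self-map \<open>g\<close> of the open positions; then crossing arcs do
  not nest among each other, and as \<open>g\<close> is involutive, the result is an involution.\<close>

lemma half_surj:
  assumes p: "p \<in> open_matchings h" and h: "h = n div 2"
    and parity: "even n \<or> open_positions h p = {}"
  shows "\<exists>\<tau>\<in>CI n {[3, 2, 1]}. half n \<tau> = p"
proof -
  define U where "U = open_positions h p"
  obtain g where "g ` U \<subseteq> U" and anti: "\<And>x y. x \<in> U \<Longrightarrow> y \<in> U \<Longrightarrow> x < y \<Longrightarrow> g y < g x"
    using ex_strict_antimono_self_map[of U] by (auto simp: U_def)
  then have g_inv: "g (g i) = i" if "i \<in> U" for i
    using strict_antimono_self_map_involution[of U g i] that by (auto simp: U_def)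
  have g: "g i \<in> U" "1 \<le> g i" "g i \<le> h" "p (g i) = 0" if "i \<in> {1..h}" "p i = 0" for i
    using \<open>g ` U \<subseteq> U\<close> that by (auto simp: U_def open_positions_def)
  have U_iff: "i \<in> U \<longleftrightarrow> i \<in> {1..h} \<and> p i = 0" for i
    by (auto simp: U_def open_positions_def)
  have n: "2 * h \<le> n" "n \<le> 2 * h + 1"
    using h by auto
  \<comment> \<open>The values on the left half; the right half is then dictated by centrosymmetry.\<close>
  define q where "q i = (if p i = 0 then n + 1 - g i else p i)" for i
  define \<tau> where "\<tau> i = (if i \<in> {1..h} then q i else if i \<in> {n + 1 - h..n} then n + 1 - q (n + 1 - i) else i)" for i
  have q_open: "q i = n + 1 - g i" "n - h < q i" "q i \<le> n" if "i \<in> {1..h}" "p i = 0" for i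
    using g[OF that] that n by (auto simp: q_def)
  have q_closed: "q i = p i" "1 \<le> q i" "q i \<le> h" if "p i \<noteq> 0" for i
    using that om_le[OF p, of i] by (auto simp: q_def)
  have q_bounds: "1 \<le> q i" "q i \<le> n" if "i \<in> {1..h}" for i
    using q_open[OF that] q_closed[of i] n by (cases "p i = 0"; force)+
  have lower: "\<tau> i = q i" if "i \<in> {1..h}" for i
    using that by (simp add: \<tau>_def)
  have upper: "\<tau> (n + 1 - i) = n + 1 - q i" if "i \<in> {1..h}" for i
    using that n by (auto simp: \<tau>_def)
  have position: thesis if i: "i \<in> {1..n}" and left: "i \<in> {1..h} \<Longrightarrow> thesis"
    and right: "\<And>i'. i' \<in> {1..h} \<Longrightarrow> i = n + 1 - i' \<Longrightarrow> thesis"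
    and middle: "n = 2 * h + 1 \<Longrightarrow> i = h + 1 \<Longrightarrow> \<tau> i = i \<Longrightarrow> thesis" for i thesis
  proof -
    have "i \<in> {1..h} \<or> n + 1 - i \<in> {1..h} \<or> (n = 2 * h + 1 \<and> i = h + 1)"
      using i n unfolding atLeastAtMost_iff by linarith
    then show thesis
    proof (elim disjE conjE)
      assume "n + 1 - i \<in> {1..h}"
      moreover have "i = n + 1 - (n + 1 - i)"
        using i by auto
      ultimately show thesis
        by (rule right)
    next
      assume "n = 2 * h + 1" "i = h + 1"
      moreover from this have "\<tau> i = i"
        by (simp add: \<tau>_def)
      ultimately show thesis
        by (rule middle)
    qed (rule left)
  qed
  have closed: "\<tau> i \<in> {1..n}" if "i \<in> {1..n}" for i
    using that
  proof (rule position)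
    fix i' assume i': "i' \<in> {1..h}" "i = n + 1 - i'"
    then show ?thesis
      using upper[of i'] q_bounds[of i'] by auto
  qed (use that lower q_bounds in auto)
  have mirror: "\<tau> (n + 1 - i) = n + 1 - \<tau> i" if "i \<in> {1..n}" for i
    using that
  proof (rule position)
    fix i' assume i': "i' \<in> {1..h}" "i = n + 1 - i'"
    then have "n + 1 - i = i'" "q i' \<le> n"
      using n q_bounds(2)[of i'] by auto
    with i' show ?thesis
      using upper[of i'] lower[of i'] by simp
  qed (use that lower upper in auto)
  have invol_low: "\<tau> (\<tau> i) = i" if i: "i \<in> {1..h}" for i
  proof (cases "p i = 0")
    case True
    have "q (g i) = n + 1 - i"
      using q_open(1)[of "g i"] g[OF i True] g_inv[of i] i True by (simp add: U_iff)
    then show ?thesis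
      using lower[OF i] q_open(1)[OF i True] upper[of "g i"] g[OF i True] i n by simp
  next
    case False
    then have "p i \<in> {1..h}" "p (p i) = i"
      using om_le[OF p, of i] om_invol[OF p, of i] by auto
    then show ?thesis
      using lower[OF i] lower[of "p i"] False i by (simp add: q_def)
  qed
  have invol: "\<tau> (\<tau> i) = i" if "i \<in> {1..n}" for i
    using that
  proof (rule position)
    fix i' assume i': "i' \<in> {1..h}" "i = n + 1 - i'"
    then have "i' \<in> {1..n}"
      using n by auto
    then have "\<tau> (\<tau> i) = n + 1 - \<tau> (\<tau> i')"
      using mirror[of i'] mirror[of "\<tau> i'"] closed[of i'] i'(2) by simp
    then show ?thesis
      using invol_low[OF i'(1)] i'(2) by simp
  qed (use invol_low in auto)
  have ci: "\<tau> \<in> centrosymmetric_involutions n"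
    unfolding centrosymmetric_involutions_iff
    using closed invol mirror n by (auto simp: \<tau>_def)
  have "\<tau> i < \<tau> j" if ij: "1 \<le> i" "i < j" "j \<le> n" "j \<le> \<tau> j" for i j
  proof -
    have "j \<in> {1..n}" "i \<in> {1..n}"
      using ij by auto
    from this(1) show ?thesis
    proof (rule position)
      assume j: "j \<in> {1..h}"
      then have i: "i \<in> {1..h}"
        using ij by auto
      show ?thesis
      proof (cases "p j = 0")
        case True
        show ?thesis
        proof (cases "p i = 0")
          case p_i: True
          then have "g j < g i"
            using anti[of i j] True i j ij(2) by (simp add: U_iff)
          then show ?thesis
            using lower[OF i] lower[OF j] q_open[OF i p_i] q_open[OF j True] g[OF i p_i] n by linarith
        next
          case False
          then show ?thesis
            using lower[OF i] lower[OF j] q_closed[of i] q_open[OF j True] n by simp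
        qed
      next
        case False
        then have "0 < p i \<and> p i < p j"
          using om_mono[OF p ij(1,2)] ij(4) lower[OF j] by (simp add: q_def)
        then show ?thesis
          using lower[OF i] lower[OF j] False by (simp add: q_def)
      qed
    next
      assume odd: "n = 2 * h + 1" and j: "j = h + 1" "\<tau> j = j"
      then have i: "i \<in> {1..h}"
        using ij by auto
      have "U = {}"
        using parity odd by (auto simp: U_def)
      then have "p i \<noteq> 0"
        using i U_iff by auto
      then show ?thesis
        using lower[OF i] q_closed[of i] j by simp
    next
      fix j' assume j': "j' \<in> {1..h}" "j = n + 1 - j'"
      have \<tau>_j: "\<tau> j = n + 1 - q j'"
        using upper[OF j'(1)] j'(2) by simp
      then have "q j' \<le> j'"
        using ij(4) j' q_bounds[OF j'(1)] n by auto
      then have "p j' \<noteq> 0"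
        using q_open[OF j'(1)] j'(1) n by fastforce
      \<comment> \<open>As \<open>j\<close> is a fixed point or the left end of an arc, the mirrored arc from \<open>m\<close> to \<open>j'\<close> lies
        in the left half, and monotonicity of \<open>p\<close> at \<open>m\<close> applies.\<close>
      define m where "m = p j'"
      have m: "1 \<le> m" "m \<le> j'" "p m = j'" "\<tau> j = n + 1 - m" "m \<le> h"
        using \<open>p j' \<noteq> 0\<close> \<open>q j' \<le> j'\<close> q_closed[of j'] om_invol[OF p, of j'] \<tau>_j by (auto simp: m_def)
      from \<open>i \<in> {1..n}\<close> show ?thesis
      proof (rule position)
        assume i: "i \<in> {1..h}"
        show ?thesis
        proof (cases "p i = 0")
          case True
          have "m \<noteq> g i"
            using g(4)[OF i True] m(3) j'(1) by auto
          moreover have "\<not> g i < m"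
            using om_mono[OF p g(2)[OF i True], of m] g(4)[OF i True] m(2,3) by auto
          ultimately have "m < g i"
            by simp
          then show ?thesis
            using lower[OF i] q_open(1)[OF i True] g[OF i True] m n by linarith
        next
          case False
          then show ?thesis
            using lower[OF i] q_closed[of i] m n by simp
        qed
      next
        assume "n = 2 * h + 1" "i = h + 1" "\<tau> i = i"
        then show ?thesis
          using m by simp
      next
        fix i' assume i': "i' \<in> {1..h}" "i = n + 1 - i'"
        have "j' < i'"
          using ij(2) i' j' by auto
        have "m < q i'"
        proof (cases "p i' = 0")
          case True
          then show ?thesis
            using q_open[OF i'(1)] m n by simp
        next
          case False
          then have "p (p i') = i'"
            by (rule om_invol[OF p])
          then have "p i' \<noteq> m" "\<not> p i' < m"
            using om_mono[OF p, of "p i'" m] False m(2,3) \<open>j' < i'\<close> by auto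
          then show ?thesis
            using q_closed(1)[OF False] by simp
        qed
        then show ?thesis
          using upper[OF i'(1)] m q_bounds[OF i'(1)] n unfolding i'(2) by linarith
      qed
    qed
  qed
  then have "\<not> contains_pattern n \<tau> [3, 2, 1]"
    unfolding ci_avoids_321_iff[OF ci] by blast
  then have "\<tau> \<in> CI n {[3, 2, 1]}"
    using ci unfolding CI_def by blast
  moreover have "half n \<tau> = p"
  proof
    fix i
    show "half n \<tau> i = p i"
    proof (cases "i \<in> {1..h}")
      case True
      then show ?thesis
        using lower[OF True] q_open[OF True] q_closed[of i] n by (cases "p i = 0") (auto simp: half_def h)
    next
      case False
      then show ?thesis
        using om_outside[OF p False] False by (auto simp: half_def h[symmetric])
    qed
  qed
  ultimately show ?thesis by blast
qed

lemma half_bij: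
  "bij_betw (half n) (CI n {[3, 2, 1]})
     {p \<in> open_matchings (n div 2). even n \<or> open_positions (n div 2) p = {}}"
proof (rule bij_betw_imageI)
  show "inj_on (half n) (CI n {[3, 2, 1]})"
    using half_inject by (blast intro: inj_onI)
  show "half n ` CI n {[3, 2, 1]} = {p \<in> open_matchings (n div 2). even n \<or> open_positions (n div 2) p = {}}"
  proof (intro equalityI subsetI)
    fix p assume "p \<in> {p \<in> open_matchings (n div 2). even n \<or> open_positions (n div 2) p = {}}"
    then show "p \<in> half n ` CI n {[3, 2, 1]}"
      using half_surj[of p "n div 2" n] by blast
  next
    fix p assume "p \<in> half n ` CI n {[3, 2, 1]}"
    then show "p \<in> {p \<in> open_matchings (n div 2). even n \<or> open_positions (n div 2) p = {}}"
      using half_open_matching open_positions_half_odd by blast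
  qed
qed

theorem CI_4321_321: "CI n {[4, 3, 2, 1], [3, 2, 1]} = CI n {[3, 2, 1]}"
  unfolding CI_def using contains_321_if_4321 by blast

theorem card_CI_even_321: "card (CI (2 * h) {[3, 2, 1]}) = 2 ^ h"
  using bij_betw_same_card[OF half_bij[of "2 * h"]] by (simp add: card_open_matchings)

theorem card_CI_odd_321: "card (CI (2 * h + 1) {[3, 2, 1]}) = h choose (h div 2)"
  using bij_betw_same_card[OF half_bij[of "2 * h + 1"]] by (simp add: card_closed_matchings)

section \<open>Avoiding 3412 and 123\<close>

text \<open>An arc in the left half and its mirror image form 2143. Without such arcs, the second
  position of an inversion lies beyond the left half, and by symmetry the first one lies before the
  right half. So no inversion is followed by another one.\<close>

lemma CI_321_avoids_2143_iff:
  assumes "\<tau> \<in> CI n {[3, 2, 1]}"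
  shows "\<not> contains_pattern n \<tau> [2, 1, 4, 3] \<longleftrightarrow> (\<forall>i. half n \<tau> i = 0 \<or> half n \<tau> i = i)"
    (is "?L \<longleftrightarrow> ?R")
proof
  note \<tau> = CI_321_D[OF assms]
  assume L: ?L
  have no_arc: "\<tau> x = x" if x: "1 \<le> x" "x \<le> \<tau> x" "\<tau> x \<le> n div 2" for x
  proof (rule ccontr)
    define y where "y = \<tau> x"
    assume "\<tau> x \<noteq> x"
    then have y: "x < y" "y \<le> n div 2" "\<tau> y = x" "\<tau> x = y"
      using x by (auto simp: y_def ci_invol[OF \<tau>(1)])
    then have "y < n + 1 - y" "n + 1 - y < n + 1 - x" "n + 1 - x \<le> n"
      using x(1) by auto
    moreover have "\<tau> (n + 1 - y) = n + 1 - x" "\<tau> (n + 1 - x) = n + 1 - y"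
      using ci_mirror[OF \<tau>(1), of x] ci_mirror[OF \<tau>(1), of y] x(1) y by auto
    then have "\<tau> y < \<tau> x" "\<tau> x < \<tau> (n + 1 - x)" "\<tau> (n + 1 - x) < \<tau> (n + 1 - y)"
      using y by auto
    ultimately have "contains_pattern n \<tau> [2, 1, 4, 3]"
      unfolding contains_2143 using x(1) y(1) by blast
    with L show False ..
  qed
  show ?R
  proof (intro allI disjCI)
    fix i assume "half n \<tau> i \<noteq> i"
    then have *: False if "half n \<tau> i \<noteq> 0"
    proof -
      have i: "1 \<le> i" "i \<le> n div 2" "\<tau> i \<le> n div 2" "\<tau> i \<noteq> i"
        using that \<open>half n \<tau> i \<noteq> i\<close> by (auto simp: half_def split: if_splits)
      moreover have "1 \<le> \<tau> i"
        using ci_bounds[OF \<tau>(1), of i] i by auto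
      ultimately show False
        using no_arc[of i] no_arc[of "\<tau> i"] by (cases "i \<le> \<tau> i") (auto simp: ci_invol[OF \<tau>(1)])
    qed
    then show "half n \<tau> i = 0" by blast
  qed
next
  note \<tau> = CI_321_D[OF assms]
  assume R: ?R
  have inversion: "n div 2 < b" if ab: "1 \<le> a" "a < b" "b \<le> n" "\<tau> b < \<tau> a" for a b
  proof (rule ccontr)
    assume "\<not> n div 2 < b"
    then have b: "b \<in> {1..n div 2}"
      using ab by auto
    have "\<tau> b < b"
      using \<tau>(2)[OF ab(1-3)] ab(4) by (cases "b \<le> \<tau> b") auto
    moreover have "1 \<le> \<tau> b"
      using ci_bounds[OF \<tau>(1), of b] ab by auto
    ultimately show False
      using R[rule_format, of b] b by (simp add: half_def split: if_splits)
  qed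
  show ?L
  proof
    assume "contains_pattern n \<tau> [2, 1, 4, 3]"
    then obtain a b c d where abcd: "1 \<le> a" "a < b" "b < c" "c < d" "d \<le> n" "\<tau> b < \<tau> a" "\<tau> d < \<tau> c"
      unfolding contains_2143 by blast
    have "n div 2 < b"
      using inversion[of a b] abcd by simp
    moreover have "n div 2 < n + 1 - c"
    proof (rule inversion[of "n + 1 - d"])
      show "\<tau> (n + 1 - c) < \<tau> (n + 1 - d)"
        using ci_mirror[OF \<tau>(1), of c] ci_mirror[OF \<tau>(1), of d] ci_bounds[OF \<tau>(1), of c] abcd by auto
    qed (use abcd in auto)
    ultimately show False
      using abcd(3) by linarith
  qed
qed

text \<open>Open arcs must not pass over fixed points. Hence in a half without closed arcs the fixed points
  come first, and it is determined by their number. For odd \<open>n\<close> all of its positions are fixed.\<close>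

lemma card_CI_2143_321:
  "card (CI n {[2, 1, 4, 3], [3, 2, 1]}) = (if even n then n div 2 + 1 else 1)"
proof -
  define h where "h = n div 2"
  define F where "F a i = (if i \<in> {1..a} then i else 0)" for a i :: nat
  let ?C = "CI n {[2, 1, 4, 3], [3, 2, 1]}" and ?A = "if even n then {0..h} else {h}"
  let ?M = "{p \<in> open_matchings h. even n \<or> open_positions h p = {}}"
  have C: "?C = {\<tau> \<in> CI n {[3, 2, 1]}. \<forall>i. half n \<tau> i = 0 \<or> half n \<tau> i = i}"
    using CI_321_avoids_2143_iff unfolding CI_def by blast
  have M: "?M = half n ` CI n {[3, 2, 1]}"
    using bij_betw_imp_surj_on[OF half_bij[of n]] by (simp add: h_def)
  have "half n ` ?C = {p \<in> ?M. \<forall>i. p i = 0 \<or> p i = i}"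
    unfolding C M by (auto simp only:)
  also have "\<dots> = F ` ?A"
  proof (intro equalityI subsetI)
    fix p assume "p \<in> {p \<in> ?M. \<forall>i. p i = 0 \<or> p i = i}"
    then have p: "p \<in> open_matchings h" "even n \<or> open_positions h p = {}" "\<And>i. p i = 0 \<or> p i = i"
      by auto
    define a where "a = Max (insert 0 {i \<in> {1..h}. p i \<noteq> 0})"
    have a: "a \<in> insert 0 {i \<in> {1..h}. p i \<noteq> 0}"
      unfolding a_def by (rule Max_in) auto
    have "p i = F a i" for i
    proof (cases "p i = 0")
      case True
      have "\<not> (1 \<le> i \<and> i \<le> a)"
      proof
        assume i: "1 \<le> i \<and> i \<le> a"
        then have "p a = a" "i < a"
          using a p(3)[of a] True by (auto simp: le_less)
        with om_mono[OF p(1), of i a] i True show False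
          by simp
      qed
      with True show ?thesis
        by (auto simp: F_def)
    next
      case False
      then have "i \<in> {1..h}"
        using om_outside[OF p(1), of i] by metis
      then have "i \<le> a" "1 \<le> i"
        using False unfolding a_def by (auto intro!: Max_ge)
      with False p(3)[of i] show ?thesis
        by (simp add: F_def)
    qed
    then have "p = F a" ..
    moreover have "a \<in> ?A"
    proof (cases "even n")
      case True
      with a show ?thesis by auto
    next
      case False
      then have "h = 0 \<or> F a h \<noteq> 0"
        using p(2) \<open>p = F a\<close> by (auto simp: open_positions_def)
      with a False show ?thesis
        by (auto simp: F_def split: if_splits)
    qed
    ultimately show "p \<in> F ` ?A" by blast
  next
    fix p assume "p \<in> F ` ?A"
    then obtain a where a: "p = F a" "a \<le> h" "even n \<or> a = h"
      by (auto split: if_splits)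
    then show "p \<in> {p \<in> ?M. \<forall>i. p i = 0 \<or> p i = i}"
      by (auto simp: open_matchings_def open_positions_def F_def)
  qed
  finally have "half n ` ?C = F ` ?A" .
  moreover have "inj_on (half n) ?C"
    using bij_betw_imp_inj_on[OF half_bij] by (rule inj_on_subset) (use C in blast)
  moreover have "inj F"
  proof (rule injI)
    fix a b assume "F a = F b"
    then have "F a a = F b a" "F a b = F b b"
      by simp_all
    then show "a = b"
      by (auto simp: F_def split: if_splits)
  qed
  ultimately have "card ?C = card ?A"
    by (metis card_image inj_on_subset subset_UNIV)
  then show ?thesis
    by (simp add: h_def)
qed

theorem card_CI_3412_123:
  "card (CI n {[3, 4, 1, 2], [1, 2, 3]}) = (if even n then n div 2 + 1 else 1)"
proof -
  have "card (CI n {[3, 4, 1, 2], [1, 2, 3]}) = card (CI n {[2, 1, 4, 3], [3, 2, 1]})"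
    using card_CI_reverse[of n "{[3, 4, 1, 2], [1, 2, 3]}"] by simp
  then show ?thesis
    unfolding card_CI_2143_321 .
qed

section \<open>The eight pairs of patterns\<close>

theorem theorem14:
  shows "(\<forall>n. card (CI n {[4,3,2,1], [1,3,2]}) = n div 2 + 1) \<and>
    ((\<forall>n. CI n {[4,3,2,1], [3,2,1]} = CI n {[3,2,1]}) \<and>
     (\<forall>h. card (CI (2 * h) {[4,3,2,1], [3,2,1]}) = 2 ^ h) \<and>
     (\<forall>h. card (CI (2 * h + 1) {[4,3,2,1], [3,2,1]}) = h choose (h div 2))) \<and>
    (\<forall>n. card (CI n {[4,3,2,1], [3,1,2]}) = tribonacci (n div 2 + 1) + tribonacci (n div 2 + 2)) \<and>
    (\<forall>n. card (CI n {[3,4,1,2], [1,3,2]}) = n div 2 + 1) \<and>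
    ((\<forall>h. card (CI (2 * h) {[3,4,1,2], [3,2,1]}) = fib (h + 2)) \<and>
     (\<forall>h. card (CI (2 * h + 1) {[3,4,1,2], [3,2,1]}) = fib (h + 1))) \<and>
    ((\<forall>n. CI n {[3,4,1,2], [3,1,2]} = CI n {[3,1,2]}) \<and>
     (\<forall>n. card (CI n {[3,4,1,2], [3,1,2]}) = 2 ^ (n div 2))) \<and>
    ((\<forall>h. card (CI (2 * h) {[3,4,1,2], [1,2,3]}) = h + 1) \<and>
     (\<forall>h. card (CI (2 * h + 1) {[3,4,1,2], [1,2,3]}) = 1)) \<and>
    (\<forall>n. card (CI n {[3,4,1,2], [4,3,2,1]}) = 2 ^ (n div 2))"
proof (intro conjI allI)
  fix n h
  show "card (CI n {[4,3,2,1], [1,3,2]}) = n div 2 + 1"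
    by (rule card_CI_4321_132)
  show "CI n {[4,3,2,1], [3,2,1]} = CI n {[3,2,1]}"
    by (rule CI_4321_321)
  show "card (CI (2 * h) {[4,3,2,1], [3,2,1]}) = 2 ^ h"
    unfolding CI_4321_321 by (rule card_CI_even_321)
  show "card (CI (2 * h + 1) {[4,3,2,1], [3,2,1]}) = h choose (h div 2)"
    unfolding CI_4321_321 by (rule card_CI_odd_321)
  show "card (CI n {[4,3,2,1], [3,1,2]}) = tribonacci (n div 2 + 1) + tribonacci (n div 2 + 2)"
    by (rule card_CI_4321_312)
  show "card (CI n {[3,4,1,2], [1,3,2]}) = n div 2 + 1"
    by (rule card_CI_3412_132)
  show "card (CI (2 * h) {[3,4,1,2], [3,2,1]}) = fib (h + 2)"
    by (rule card_CI_even_3412_321)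
  show "card (CI (2 * h + 1) {[3,4,1,2], [3,2,1]}) = fib (h + 1)"
    by (rule card_CI_odd_3412_321)
  show "CI n {[3,4,1,2], [3,1,2]} = CI n {[3,1,2]}"
    by (rule CI_3412_312)
  show "card (CI n {[3,4,1,2], [3,1,2]}) = 2 ^ (n div 2)"
    unfolding CI_3412_312 by (rule card_CI_312)
  show "card (CI (2 * h) {[3,4,1,2], [1,2,3]}) = h + 1"
    unfolding card_CI_3412_123 by simp
  show "card (CI (2 * h + 1) {[3,4,1,2], [1,2,3]}) = 1"
    unfolding card_CI_3412_123 by simp
  show "card (CI n {[3,4,1,2], [4,3,2,1]}) = 2 ^ (n div 2)"
    by (rule card_CI_3412_4321)
qed

end
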